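(* For a polynomial $f(x)\in\mathbb{Q}[x]$ let $F$ denote its splitting field over $\mathbb{Q}$. Then: 1. if $f(x)=x^6+3(3n+1)^2$ with $n\in\mathbb{Z}$, then $\operatorname{Gal}(F/\mathbb{Q})\cong S_3$; 2. if $f(x)=x^6+(5n+1)^3x^3+(5n+1)^6$ with $n\in\mathbb{Z}$, then $\operatorname{Gal}(F/\mathbb{Q})\cong C_6$; 3. if $f(x)=x^6+px^3+p^2$ where $p\equiv 1\bmod 5$ is a prime, then $\operatorname{Gal}(F/\mathbb{Q})\cong C_3\times S_3$.
   Context: $C_n$ is the cyclic group of order $n$ and $S_3$ is the symmetric group on $3$ letters. *)

theory Defs
  imports
    "HOL-Algebra.Algebra"
    "HOL-Algebra.Algebraic_Closure_Type"
    "HOL-Computational_Algebra.Computational_Algebra"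
    "HOL-Number_Theory.Cong"
    Complex_Main
begin

(* The splitting field over the rationals of a nonzero f, realised inside the complex numbers. *)
definition splitting_field :: "rat poly \<Rightarrow> complex ring" where
  "splitting_field f =
     (ring_of_type_algebra :: complex ring)
       \<lparr>carrier := generate_field ring_of_type_algebra
          (\<rat> \<union> {z. poly (map_poly of_rat f) z = 0})\<rparr>"

(* As in BijGroup, automorphisms are extensional on the carrier of L, so that each automorphism
   of L is represented by exactly one HOL function. *)
definition galois_group :: "('a, 'b) ring_scheme \<Rightarrow> 'a set \<Rightarrow> ('a \<Rightarrow> 'a) monoid" where
  "galois_group L K =
     (BijGroup (carrier L))
       \<lparr>carrier := {\<sigma> \<in> ring_hom L L \<inter> Bij (carrier L). \<forall>x\<in>K. \<sigma> x = x}\<rparr>"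

lemma field_splitting_field: "field (splitting_field f)"
proof -
  interpret field "ring_of_type_algebra :: complex ring"
    by (rule field_from_type_algebra)
  show ?thesis
    unfolding splitting_field_def
    by (rule generate_field_is_field) (simp add: ring_of_type_algebra_def)
qed

lemma group_galois_group:
  assumes "ring L" "K \<subseteq> carrier L"
  shows "group (galois_group L K)"
proof -
  interpret L: ring L by fact
  interpret B: group "BijGroup (carrier L)" by (rule group_BijGroup)
  let ?A = "{\<sigma> \<in> ring_hom L L \<inter> Bij (carrier L). \<forall>x\<in>K. \<sigma> x = x}"
  have inv: "inv\<^bsub>BijGroup (carrier L)\<^esub> \<sigma> = (\<lambda>x\<in>carrier L. inv_into (carrier L) \<sigma> x)"
    if "\<sigma> \<in> Bij (carrier L)" for \<sigma>
    using that by (rule inv_BijGroup)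
  have "subgroup ?A (BijGroup (carrier L))"
  proof (rule B.subgroupI)
    show "?A \<subseteq> carrier (BijGroup (carrier L))" by (auto simp: BijGroup_def)
    have "(\<lambda>x\<in>carrier L. x) \<in> ?A"
      using assms(2) by (auto simp: ring_hom_def id_Bij)
    then show "?A \<noteq> {}" by blast
  next
    fix \<sigma> assume s: "\<sigma> \<in> ?A"
    then have b: "bij_betw \<sigma> (carrier L) (carrier L)" and B: "\<sigma> \<in> Bij (carrier L)"
      and h: "\<sigma> \<in> ring_hom L L"
      by (auto simp: Bij_def)
    let ?i = "inv_into (carrier L) \<sigma>"
    have i: "?i x \<in> carrier L" "\<sigma> (?i x) = x" if "x \<in> carrier L" for x
      using b that by (auto simp: bij_betw_def inv_into_into f_inv_into_f)
    have ii: "?i (\<sigma> x) = x" if "x \<in> carrier L" for x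
      using b that by (auto simp: bij_betw_def)
    have "(\<lambda>x\<in>carrier L. ?i x) \<in> ring_hom L L"
    proof (rule ring_hom_memI)
      fix x y assume xy: "x \<in> carrier L" "y \<in> carrier L"
      show "(\<lambda>x\<in>carrier L. ?i x) x \<in> carrier L" using i xy by simp
      have "?i (x \<otimes>\<^bsub>L\<^esub> y) = ?i (\<sigma> (?i x \<otimes>\<^bsub>L\<^esub> ?i y))"
        using i xy ring_hom_mult[OF h] by simp
      then show "(\<lambda>x\<in>carrier L. ?i x) (x \<otimes>\<^bsub>L\<^esub> y) =
          (\<lambda>x\<in>carrier L. ?i x) x \<otimes>\<^bsub>L\<^esub> (\<lambda>x\<in>carrier L. ?i x) y"
        using i xy ii by simp
      have "?i (x \<oplus>\<^bsub>L\<^esub> y) = ?i (\<sigma> (?i x \<oplus>\<^bsub>L\<^esub> ?i y))"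
        using i xy ring_hom_add[OF h] by simp
      then show "(\<lambda>x\<in>carrier L. ?i x) (x \<oplus>\<^bsub>L\<^esub> y) =
          (\<lambda>x\<in>carrier L. ?i x) x \<oplus>\<^bsub>L\<^esub> (\<lambda>x\<in>carrier L. ?i x) y"
        using i xy ii by simp
    next
      show "(\<lambda>x\<in>carrier L. ?i x) \<one>\<^bsub>L\<^esub> = \<one>\<^bsub>L\<^esub>"
        using ii[of "\<one>\<^bsub>L\<^esub>"] ring_hom_one[OF h] by simp
    qed
    moreover have "\<forall>x\<in>K. (\<lambda>x\<in>carrier L. ?i x) x = x"
    proof
      fix x assume x: "x \<in> K"
      then have "\<sigma> x = x" "x \<in> carrier L" using s assms(2) by auto
      then show "(\<lambda>x\<in>carrier L. ?i x) x = x" using ii[of x] by simp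
    qed
    ultimately show "inv\<^bsub>BijGroup (carrier L)\<^esub> \<sigma> \<in> ?A"
      using B by (simp add: inv restrict_inv_into_Bij)
  next
    fix \<sigma> \<tau> assume st: "\<sigma> \<in> ?A" "\<tau> \<in> ?A"
    have "compose (carrier L) \<sigma> \<tau> \<in> ring_hom L L"
    proof (rule ring_hom_memI)
      have h: "\<sigma> \<in> ring_hom L L" "\<tau> \<in> ring_hom L L" using st by auto
      fix x y assume xy: "x \<in> carrier L" "y \<in> carrier L"
      note c = ring_hom_closed[OF h(1)] ring_hom_closed[OF h(2)]
      show "compose (carrier L) \<sigma> \<tau> x \<in> carrier L"
        using xy c by (simp add: compose_eq)
      show "compose (carrier L) \<sigma> \<tau> (x \<otimes>\<^bsub>L\<^esub> y) =
          compose (carrier L) \<sigma> \<tau> x \<otimes>\<^bsub>L\<^esub> compose (carrier L) \<sigma> \<tau> y"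
        using xy c by (simp add: compose_eq ring_hom_mult[OF h(1)] ring_hom_mult[OF h(2)])
      show "compose (carrier L) \<sigma> \<tau> (x \<oplus>\<^bsub>L\<^esub> y) =
          compose (carrier L) \<sigma> \<tau> x \<oplus>\<^bsub>L\<^esub> compose (carrier L) \<sigma> \<tau> y"
        using xy c by (simp add: compose_eq ring_hom_add[OF h(1)] ring_hom_add[OF h(2)])
    next
      show "compose (carrier L) \<sigma> \<tau> \<one>\<^bsub>L\<^esub> = \<one>\<^bsub>L\<^esub>"
        using st by (simp add: compose_eq ring_hom_one[of \<sigma> L L] ring_hom_one[of \<tau> L L])
    qed
    moreover have "\<forall>x\<in>K. compose (carrier L) \<sigma> \<tau> x = x"
      using st assms(2) by (auto simp: compose_def)
    ultimately show "\<sigma> \<otimes>\<^bsub>BijGroup (carrier L)\<^esub> \<tau> \<in> ?A"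
      using st by (auto simp: BijGroup_def compose_Bij)
  qed
  then show ?thesis
    unfolding galois_group_def by (rule B.subgroup_imp_group)
qed

end

theory Submission
  imports Defs
begin

text \<open>Each splitting field is \<open>\<rat>(\<omega>, z, c)\<close> for a primitive cube root of unity \<open>\<omega>\<close>, where \<open>z\<close> is
  a primitive ninth root of unity with \<open>z\<^sup>3 = \<omega>\<close> or \<open>z = 1\<close>, and \<open>c\<close> is a real cube root of an
  integer or \<open>c = 1\<close>: in the first family \<open>z = 1\<close> and \<open>c\<^sup>3 = 3 (3 n + 1)\<^sup>2\<close>, in the second
  \<open>c = 1\<close>, in the third \<open>c\<^sup>3 = p\<close>. Over a field containing \<open>\<omega>\<close>, adjoining a proper cube root
  \<open>\<alpha>\<close> produces the automorphism \<open>\<alpha> \<mapsto> \<omega> \<alpha>\<close>; together with complex conjugation these automorphisms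
  realise all possible values on the generators. An automorphism is therefore described by a sign
  \<open>e\<close> and residues \<open>j\<close>, \<open>k\<close> modulo 3 with \<open>\<omega> \<mapsto> \<omega>\<^sup>e\<close>, \<open>z \<mapsto> (\<omega>\<^sup>j z)\<^sup>e\<close>, \<open>c \<mapsto> \<omega>\<^sup>k c\<close>. In these
  coordinates the pairs \<open>(e, k)\<close> multiply like the affine maps \<open>i \<mapsto> e i + k\<close> modulo 3, which form
  \<open>S\<^sub>3\<close>, while \<open>j\<close> is simply additive. The required independence of \<open>z\<close> and \<open>c\<close> follows by
  comparing absolute values.\<close>

section \<open>Subfields of the complex numbers\<close>

text \<open>\<open>inverse_mem\<close> carries no nonzero condition because
  \<open>inverse 0 = 0\<close>.\<close>

locale complex_subfield =
  fixes K :: "complex set"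
  assumes one_mem: "1 \<in> K"
    and diff_mem: "\<And>x y. x \<in> K \<Longrightarrow> y \<in> K \<Longrightarrow> x - y \<in> K"
    and mult_mem: "\<And>x y. x \<in> K \<Longrightarrow> y \<in> K \<Longrightarrow> x * y \<in> K"
    and inverse_mem: "\<And>x. x \<in> K \<Longrightarrow> inverse x \<in> K"
begin

lemma zero_mem: "0 \<in> K"
  using diff_mem[OF one_mem one_mem] by simp

lemma minus_mem: "x \<in> K \<Longrightarrow> - x \<in> K"
  using diff_mem[OF zero_mem, of x] by simp

lemma add_mem: "x \<in> K \<Longrightarrow> y \<in> K \<Longrightarrow> x + y \<in> K"
  using diff_mem[of x "- y"] minus_mem by simp

lemma divide_mem: "x \<in> K \<Longrightarrow> y \<in> K \<Longrightarrow> x / y \<in> K"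
  by (simp add: divide_inverse mult_mem inverse_mem)

lemma power_mem: "x \<in> K \<Longrightarrow> x ^ n \<in> K"
  by (induction n) (auto simp: one_mem mult_mem)

lemma power_int_mem: "x \<in> K \<Longrightarrow> x powi n \<in> K"
  by (auto simp: power_int_def power_mem inverse_mem)

lemma of_nat_mem: "of_nat n \<in> K"
  by (induction n) (auto simp: zero_mem one_mem add_mem)

lemma of_int_mem: "of_int n \<in> K"
  by (cases n) (auto simp: of_nat_mem minus_mem simp del: of_nat_Suc)

lemma numeral_mem: "numeral n \<in> K"
  using of_nat_mem[of "numeral n"] by simp

lemma Rats_subset: "\<rat> \<subseteq> K"
proof
  fix x :: complex assume "x \<in> \<rat>"
  then obtain a b where "x = of_int a / of_int b" by (auto elim: Rats_cases')
  then show "x \<in> K" by (simp add: divide_mem of_int_mem)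
qed

lemmas mem_intros = zero_mem one_mem minus_mem add_mem diff_mem mult_mem inverse_mem divide_mem
  power_mem power_int_mem of_nat_mem of_int_mem numeral_mem

end

section \<open>Generated subfields as hulls\<close>

lemma complex_subfield_Inter: "(\<And>K. K \<in> A \<Longrightarrow> complex_subfield K) \<Longrightarrow> complex_subfield (\<Inter> A)"
  unfolding complex_subfield_def by blast

lemma complex_subfield_hull: "complex_subfield (complex_subfield hull S)"
  by (rule hull_in) (use complex_subfield_Inter in blast)

text \<open>Bridge from the record-based notion to type-class arithmetic: the points to identify are
  negation and, away from 0, inversion in \<open>ring_of_type_algebra\<close>.\<close>

lemma subfield_iff_complex_subfield:
  "subfield K (ring_of_type_algebra :: complex ring) \<longleftrightarrow> complex_subfield K"
proof -
  interpret R: field "ring_of_type_algebra :: complex ring"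
    by (rule field_from_type_algebra)
  have minus: "\<ominus>\<^bsub>ring_of_type_algebra\<^esub> x = - x" for x :: complex
    by (rule sym, rule R.sum_zero_eq_neg) (auto simp: ring_of_type_algebra_def)
  have inv: "inv\<^bsub>ring_of_type_algebra\<^esub> x = inverse x" if "x \<noteq> 0" for x :: complex
    by (rule R.comm_inv_char) (use that in \<open>auto simp: ring_of_type_algebra_def\<close>)
  show ?thesis
  proof
    assume "subfield K (ring_of_type_algebra :: complex ring)"
    then interpret S: subfield K "ring_of_type_algebra :: complex ring" .
    note sub = subringE(3,5-7)[OF S.subring_axioms]
    have *: "x + y \<in> K" "- x \<in> K" "x * y \<in> K" if "x \<in> K" "y \<in> K" for x y
      using sub(4)[OF that] sub(2)[OF that(1)] sub(3)[OF that] unfolding minus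
      by (simp_all add: ring_of_type_algebra_def)
    show "complex_subfield K"
    proof
      show "1 \<in> K"
        using subringE(3)[OF S.subring_axioms] by (simp add: ring_of_type_algebra_def)
      fix x y assume xy: "x \<in> K" "y \<in> K"
      show "x - y \<in> K" using *(1)[OF xy(1) *(2)[OF xy(2) xy(2)]] by (simp only: diff_conv_add_uminus)
      show "x * y \<in> K" using *(3)[OF xy] .
    next
      fix x assume x: "x \<in> K"
      show "inverse x \<in> K"
      proof (cases "x = 0")
        case False
        then show ?thesis
          using R.subfield_m_inv(1)[OF S.subfield_axioms, of x] x inv
          by (simp add: ring_of_type_algebra_def)
      qed (use x in auto)
    qed
  next
    assume "complex_subfield K"
    then interpret K: complex_subfield K .
    show "subfield K (ring_of_type_algebra :: complex ring)"
    proof (rule R.subfieldI')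
      show "subring K (ring_of_type_algebra :: complex ring)"
      proof (rule R.subringI)
        fix x y assume "x \<in> K" "y \<in> K"
        then show "\<ominus>\<^bsub>ring_of_type_algebra\<^esub> x \<in> K"
          "x \<otimes>\<^bsub>ring_of_type_algebra\<^esub> y \<in> K" "x \<oplus>\<^bsub>ring_of_type_algebra\<^esub> y \<in> K"
          unfolding minus by (simp_all add: ring_of_type_algebra_def K.mem_intros)
      qed (simp_all add: ring_of_type_algebra_def K.one_mem)
      fix k assume "k \<in> K - {\<zero>\<^bsub>ring_of_type_algebra :: complex ring\<^esub>}"
      then have "k \<in> K" "k \<noteq> 0" by (simp_all add: ring_of_type_algebra_def)
      then show "inv\<^bsub>ring_of_type_algebra\<^esub> k \<in> K"
        by (simp add: inv K.inverse_mem)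
    qed
  qed
qed

lemma generate_field_eq_hull:
  "generate_field (ring_of_type_algebra :: complex ring) S = complex_subfield hull S"
proof -
  interpret R: field "ring_of_type_algebra :: complex ring"
    by (rule field_from_type_algebra)
  show ?thesis
    by (subst R.generate_field_min_subfield2)
      (simp_all add: ring_of_type_algebra_def hull_def
        subfield_iff_complex_subfield[unfolded ring_of_type_algebra_def])
qed

abbreviation complex_ring :: "complex set \<Rightarrow> complex ring" where
  "complex_ring L \<equiv> ring_of_type_algebra\<lparr>carrier := L\<rparr>"

text \<open>Minimality is tested against subfields containing the roots alone, since every subfield
  contains the rationals.\<close>

lemma splitting_field_eq:
  assumes "complex_subfield L" and "{z. poly (map_poly of_rat f) z = 0} \<subseteq> L"
    and "\<And>S. complex_subfield S \<Longrightarrow> {z. poly (map_poly of_rat f) z = 0} \<subseteq> S \<Longrightarrow> L \<subseteq> S"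
  shows "splitting_field f = complex_ring L"
proof -
  let ?S = "\<rat> \<union> {z. poly (map_poly of_rat f) z = 0}"
  have "complex_subfield hull ?S = L"
    by (rule hull_unique) (use assms complex_subfield.Rats_subset in blast)+
  then show ?thesis
    unfolding splitting_field_def generate_field_eq_hull by simp
qed

section \<open>Automorphisms\<close>

text \<open>The codomain is all of the complex numbers; that \<sigma> maps \<open>L\<close> onto
  \<open>L\<close> is demanded separately in \<open>mem_Gal_iff\<close>.\<close>

locale subfield_hom = complex_subfield L for L +
  fixes \<sigma> :: "complex \<Rightarrow> complex"
  assumes hom_one: "\<sigma> 1 = 1"
    and hom_add: "\<And>x y. x \<in> L \<Longrightarrow> y \<in> L \<Longrightarrow> \<sigma> (x + y) = \<sigma> x + \<sigma> y"
    and hom_mult: "\<And>x y. x \<in> L \<Longrightarrow> y \<in> L \<Longrightarrow> \<sigma> (x * y) = \<sigma> x * \<sigma> y"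
begin

lemma hom_zero: "\<sigma> 0 = 0"
  using hom_add[OF zero_mem zero_mem] by simp

lemma hom_minus: "x \<in> L \<Longrightarrow> \<sigma> (- x) = - \<sigma> x"
  using hom_add[of x "- x"] by (simp add: minus_mem hom_zero eq_neg_iff_add_eq_0 add.commute)

lemma hom_diff: "x \<in> L \<Longrightarrow> y \<in> L \<Longrightarrow> \<sigma> (x - y) = \<sigma> x - \<sigma> y"
  using hom_add[of x "- y"] by (simp add: minus_mem hom_minus)

lemma hom_inverse: "x \<in> L \<Longrightarrow> \<sigma> (inverse x) = inverse (\<sigma> x)"
proof (cases "x = 0")
  case False
  assume "x \<in> L"
  then have "\<sigma> x * \<sigma> (inverse x) = 1"
    using hom_mult[of x "inverse x"] False by (simp add: inverse_mem hom_one)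
  then show ?thesis by (rule inverse_unique[symmetric])
qed (simp add: hom_zero)

lemma hom_power: "x \<in> L \<Longrightarrow> \<sigma> (x ^ n) = \<sigma> x ^ n"
  by (induction n) (simp_all add: hom_one hom_mult power_mem)

lemma hom_power_int: "x \<in> L \<Longrightarrow> \<sigma> (x powi n) = \<sigma> x powi n"
  by (simp add: power_int_def hom_power hom_inverse power_mem inverse_mem)

lemma hom_eq_0_iff: "x \<in> L \<Longrightarrow> \<sigma> x = 0 \<longleftrightarrow> x = 0"
  using hom_mult[of x "inverse x"] by (cases "x = 0") (auto simp: hom_zero hom_one inverse_mem)

lemma hom_inj: "inj_on \<sigma> L"
  by (rule inj_onI) (metis diff_mem hom_diff hom_eq_0_iff right_minus_eq)

end

text \<open>Serves twice: a homomorphism is determined by its values on generators, and comparison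
  with the identity shows that it fixes the rationals.\<close>

lemma complex_subfield_equalizer:
  assumes "subfield_hom L \<sigma>" "subfield_hom L \<tau>"
  shows "complex_subfield {x \<in> L. \<sigma> x = \<tau> x}"
proof -
  interpret s: subfield_hom L \<sigma> by fact
  interpret t: subfield_hom L \<tau> by fact
  show ?thesis
    by unfold_locales
      (auto simp: s.mem_intros s.hom_one t.hom_one s.hom_diff t.hom_diff s.hom_mult t.hom_mult
        s.hom_inverse t.hom_inverse)
qed

lemma subfield_hom_id: "complex_subfield L \<Longrightarrow> subfield_hom L (\<lambda>x. x)"
  by (simp add: subfield_hom_def subfield_hom_axioms_def)

lemma subfield_hom_fixes_Rats: "subfield_hom L \<sigma> \<Longrightarrow> x \<in> \<rat> \<Longrightarrow> \<sigma> x = x"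
  using complex_subfield.Rats_subset[OF complex_subfield_equalizer[OF _ subfield_hom_id]]
    subfield_hom.axioms(1) by blast

section \<open>Automorphism groups of subfields of the complex numbers\<close>

abbreviation Gal :: "complex set \<Rightarrow> (complex \<Rightarrow> complex) monoid" where
  "Gal L \<equiv> galois_group (complex_ring L) \<rat>"

text \<open>Injectivity and the fixing of the rationals are automatic for a field
  homomorphism.\<close>

lemma mem_Gal_iff:
  assumes "complex_subfield L"
  shows "\<sigma> \<in> carrier (Gal L) \<longleftrightarrow>
    \<sigma> \<in> extensional L \<and> \<sigma> ` L = L \<and> subfield_hom L \<sigma>"
proof
  assume "\<sigma> \<in> carrier (Gal L)"
  then show "\<sigma> \<in> extensional L \<and> \<sigma> ` L = L \<and> subfield_hom L \<sigma>"
    using assms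
    by (auto simp: galois_group_def ring_of_type_algebra_def ring_hom_def Bij_def bij_betw_def
        subfield_hom_def subfield_hom_axioms_def)
next
  assume *: "\<sigma> \<in> extensional L \<and> \<sigma> ` L = L \<and> subfield_hom L \<sigma>"
  then interpret subfield_hom L \<sigma> by blast
  show "\<sigma> \<in> carrier (Gal L)"
    using * hom_inj subfield_hom_fixes_Rats[OF subfield_hom_axioms]
    by (auto simp: galois_group_def ring_of_type_algebra_def ring_hom_def Bij_def bij_betw_def
        hom_one hom_add hom_mult)
qed

lemma Gal_mult:
  assumes "\<sigma> \<in> carrier (Gal L)" "\<tau> \<in> carrier (Gal L)"
  shows "\<sigma> \<otimes>\<^bsub>Gal L\<^esub> \<tau> = compose L \<sigma> \<tau>"
  using assms by (auto simp: galois_group_def BijGroup_def)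

lemma group_Gal:
  assumes "complex_subfield L"
  shows "group (Gal L)"
proof (rule group_galois_group)
  interpret R: field "ring_of_type_algebra :: complex ring"
    by (rule field_from_type_algebra)
  show "ring (complex_ring L)"
    using assms by (intro R.subring_is_ring subfieldE(1)) (simp add: subfield_iff_complex_subfield)
  show "\<rat> \<subseteq> carrier (complex_ring L)"
    using complex_subfield.Rats_subset[OF assms] by simp
qed

lemma cnj_mem_Gal:
  assumes "complex_subfield L" "cnj ` L \<subseteq> L"
  shows "restrict cnj L \<in> carrier (Gal L)"
proof -
  interpret complex_subfield L by fact
  have "x \<in> cnj ` L" if "x \<in> L" for x
    using assms(2) that by (intro image_eqI[of _ _ "cnj x"]) auto
  then have "cnj ` L = L" using assms(2) by blast
  then show ?thesis
    by (subst mem_Gal_iff) (auto simp: assms(1) subfield_hom_def subfield_hom_axioms_def mem_intros)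
qed

section \<open>Primitive cube and ninth roots of unity\<close>

definition omega :: complex where "omega = cis (2 * pi / 3)"

definition zeta :: complex where "zeta = cis (2 * pi / 9)"

lemma omega_eq: "omega = Complex (- 1 / 2) (sqrt 3 / 2)"
  by (simp add: omega_def cis.ctr cos_120 sin_120)

lemma omega_sum: "omega\<^sup>2 + omega + 1 = 0"
  by (simp add: omega_eq power2_eq_square complex_eq_iff)

lemma omega_cube: "omega ^ 3 = 1"
  using omega_sum by Groebner_Basis.algebra

lemma omega_neq_0: "omega \<noteq> 0"
  by (simp add: omega_def)

lemma omega_neq_1: "omega \<noteq> 1"
  by (simp add: omega_eq complex_eq_iff)

lemma omega_sq: "omega\<^sup>2 = - omega - 1"
  using omega_sum by Groebner_Basis.algebra

lemma omega_sq_neq_1: "omega\<^sup>2 \<noteq> 1"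
  by (simp add: omega_sq) (simp add: omega_eq complex_eq_iff)

lemma omega_sq_neq: "omega\<^sup>2 \<noteq> omega"
  by (simp add: omega_sq) (simp add: omega_eq complex_eq_iff)

text \<open>The cofactor of \<open>x + y + z\<close> in \<open>x^3 + y^3 + z^3 - 3 x y z\<close>,
  split over \<open>omega\<close>; it evaluates the product of two conjugates in a norm.\<close>

lemma omega_norm_form:
  "(x + omega * y + omega\<^sup>2 * z) * (x + omega\<^sup>2 * y + omega * z) =
    x\<^sup>2 + y\<^sup>2 + z\<^sup>2 - x * y - x * z - y * z"
  using omega_sum by Groebner_Basis.algebra

lemma zeta_cube: "zeta ^ 3 = omega"
  by (simp add: omega_def zeta_def DeMoivre)

text \<open>Written as a power with exponent -1 so that conjugation becomes the case
  \<open>e = - 1\<close> of \<open>acts\<close>.\<close>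

lemma cnj_omega: "cnj omega = omega powi (-1)"
  by (simp add: omega_def cis_cnj cis_inverse power_int_minus)

lemma cnj_zeta: "cnj zeta = zeta powi (-1)"
  by (simp add: zeta_def cis_cnj cis_inverse power_int_minus)

lemma omega_powi_mod: "omega powi (n mod 3) = omega powi n"
proof -
  have "omega powi n = omega powi (n mod 3 + 3 * (n div 3))" by simp
  also have "\<dots> = omega powi (n mod 3) * omega powi (3 * (n div 3))"
    by (rule power_int_add) (simp add: omega_neq_0)
  also have "omega powi (3 * (n div 3)) = 1"
    by (subst power_int_mult) (simp add: omega_cube)
  finally show ?thesis by simp
qed

lemma omega_powi_eq_iff: "omega powi m = omega powi n \<longleftrightarrow> m mod 3 = n mod 3"
proof
  have small: "i = j" if "omega powi i = omega powi j" "i = 0 \<or> i = 1 \<or> i = 2" "j = 0 \<or> j = 1 \<or> j = 2"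
    for i j :: int
    using that omega_neq_1 omega_sq_neq_1 omega_sq_neq by (elim disjE) (simp_all add: eq_commute[of _ "omega\<^sup>2"] eq_commute[of 1])
  assume "omega powi m = omega powi n"
  then have "omega powi (m mod 3) = omega powi (n mod 3)" by (simp only: omega_powi_mod)
  then show "m mod 3 = n mod 3"
    by (rule small) presburger+
next
  assume "m mod 3 = n mod 3"
  then have "omega powi (m mod 3) = omega powi (n mod 3)" by (rule arg_cong)
  then show "omega powi m = omega powi n" by (simp only: omega_powi_mod)
qed

lemma cube_eq_cases:
  fixes x y :: complex
  assumes "x ^ 3 = y ^ 3"
  obtains i where "i \<in> {0, 1, 2 :: nat}" "x = omega ^ i * y"
proof -
  have "(x - y) * (x - omega * y) * (x - omega\<^sup>2 * y) = x ^ 3 - y ^ 3"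
    using omega_sum by Groebner_Basis.algebra
  then have "x = omega ^ 0 * y \<or> x = omega ^ 1 * y \<or> x = omega ^ 2 * y"
    using assms by simp
  then show thesis using that by blast
qed

section \<open>Pure cubic extensions\<close>

text \<open>Kummer setting: with the cube roots of unity in \<open>K\<close>, the condition
  \<open>\<alpha> \<notin> K\<close> already forces degree 3, as \<open>independent\<close>
  shows.\<close>

locale pure_cubic = complex_subfield K for K +
  fixes \<alpha> :: complex
  assumes omega_mem: "omega \<in> K" and cube_mem: "\<alpha> ^ 3 \<in> K" and not_mem: "\<alpha> \<notin> K"
begin

text \<open>The base point is an argument because the same coordinates are evaluated at \<alpha> and
  at its conjugates.\<close>

definition quad :: "complex \<Rightarrow> complex \<times> complex \<times> complex \<Rightarrow> complex" where
  "quad \<beta> = (\<lambda>(a, b, d). a + b * \<beta> + d * \<beta>\<^sup>2)"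

definition adjoined :: "complex set" where
  "adjoined = quad \<alpha> ` (K \<times> K \<times> K)"

text \<open>The Kummer automorphism: coordinates are read off at \<alpha> and evaluated at
  \<open>omega * \<alpha>\<close>. It is restricted because members of the Galois group are
  extensional.\<close>

definition rot :: "complex \<Rightarrow> complex" where
  "rot = (\<lambda>x \<in> adjoined. quad (omega * \<alpha>) (inv_into (K \<times> K \<times> K) (quad \<alpha>) x))"

text \<open>A quadratic relation \<open>\<alpha>^2 = u \<alpha> + v\<close> makes
  \<open>\<alpha>^3\<close> linear in \<alpha>. Either this can be solved for \<alpha> inside
  \<open>K\<close>, or \<open>\<alpha>^3 = (- u)^3\<close> and \<alpha> is a power of
  \<open>omega\<close> times \<open>- u\<close>; both contradict \<open>not_mem\<close>.\<close>

lemma independent: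
  assumes "a \<in> K" "b \<in> K" "d \<in> K" and eq: "a + b * \<alpha> + d * \<alpha>\<^sup>2 = 0"
  shows "a = 0 \<and> b = 0 \<and> d = 0"
proof (cases "d = 0")
  case True
  have "b = 0"
  proof (rule ccontr)
    assume "b \<noteq> 0"
    then have "\<alpha> = - a / b" using eq True by (simp add: field_simps eq_neg_iff_add_eq_0)
    then show False using not_mem assms by (simp add: mem_intros)
  qed
  then show ?thesis using True eq by simp
next
  case False
  define u v where "u = - b / d" and "v = - a / d"
  have uv: "u \<in> K" "v \<in> K" using assms by (simp_all add: u_def v_def mem_intros)
  have sq: "\<alpha>\<^sup>2 = u * \<alpha> + v"
    using eq False by (simp add: u_def v_def field_simps) Groebner_Basis.algebra
  then have cube: "\<alpha> ^ 3 = (u\<^sup>2 + v) * \<alpha> + u * v" by Groebner_Basis.algebra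
  have "u\<^sup>2 + v = 0"
  proof (rule ccontr)
    assume "u\<^sup>2 + v \<noteq> 0"
    then have "\<alpha> = (\<alpha> ^ 3 - u * v) / (u\<^sup>2 + v)" using cube by simp
    moreover have "(\<alpha> ^ 3 - u * v) / (u\<^sup>2 + v) \<in> K"
      using uv cube_mem by (simp add: mem_intros)
    ultimately show False using not_mem by simp
  qed
  then have "\<alpha> ^ 3 = (- u) ^ 3" using cube by Groebner_Basis.algebra
  then obtain i where "\<alpha> = omega ^ i * (- u)" by (rule cube_eq_cases)
  then show ?thesis using not_mem uv omega_mem by (simp add: mem_intros)
qed

lemma quad_inj: "inj_on (quad \<alpha>) (K \<times> K \<times> K)"
proof (rule inj_onI)
  fix p q assume "p \<in> K \<times> K \<times> K" "q \<in> K \<times> K \<times> K" "quad \<alpha> p = quad \<alpha> q"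
  moreover obtain a b d a' b' d' where "p = (a, b, d)" "q = (a', b', d')"
    by (metis prod_cases3)
  ultimately show "p = q"
    using independent[of "a - a'" "b - b'" "d - d'"]
    by (simp add: quad_def algebra_simps mem_intros)
qed

lemma rot_quad:
  assumes "p \<in> K \<times> K \<times> K"
  shows "rot (quad \<alpha> p) = quad (omega * \<alpha>) p"
  using assms quad_inj by (simp add: rot_def adjoined_def inv_into_f_f)

lemma adjoinedE:
  assumes "x \<in> adjoined"
  obtains a b d where "a \<in> K" "b \<in> K" "d \<in> K" "x = quad \<alpha> (a, b, d)"
  using assms by (auto simp: adjoined_def)

lemma adjoinedI: "a \<in> K \<Longrightarrow> b \<in> K \<Longrightarrow> d \<in> K \<Longrightarrow> quad \<alpha> (a, b, d) \<in> adjoined"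
  by (simp add: adjoined_def)

text \<open>The product coordinates involve the base point only through its cube, which \<alpha> and
  \<open>omega * \<alpha>\<close> share. Hence \<open>rot\<close> is multiplicative.\<close>

lemma quad_mult:
  assumes "\<beta> ^ 3 = t"
  shows "quad \<beta> (a, b, d) * quad \<beta> (a', b', d') =
    quad \<beta> (a * a' + (b * d' + d * b') * t, a * b' + b * a' + d * d' * t, a * d' + b * b' + d * a')"
  unfolding quad_def prod.case assms[symmetric] by Groebner_Basis.algebra

lemma quad_rot_mem: "p \<in> K \<times> K \<times> K \<Longrightarrow> quad (omega * \<alpha>) p \<in> adjoined"
  using omega_mem adjoinedI[of "fst p" "fst (snd p) * omega" "snd (snd p) * omega\<^sup>2"]
  by (auto simp: quad_def mem_intros power_mult_distrib mult.assoc split: prod.splits)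

text \<open>The inverse comes from the norm: the product of the three conjugates of an element lies
  in \<open>K\<close>.\<close>

lemma adjoined_subfield: "complex_subfield adjoined"
proof
  show "1 \<in> adjoined"
    using adjoinedI[of 1 0 0] by (simp add: quad_def mem_intros)
  fix x y assume "x \<in> adjoined" "y \<in> adjoined"
  then obtain a b d a' b' d' where K: "a \<in> K" "b \<in> K" "d \<in> K" "a' \<in> K" "b' \<in> K" "d' \<in> K"
    and xy: "x = quad \<alpha> (a, b, d)" "y = quad \<alpha> (a', b', d')"
    by (metis adjoinedE)
  have "x - y = quad \<alpha> (a - a', b - b', d - d')"
    by (simp add: xy quad_def algebra_simps)
  then show "x - y \<in> adjoined" using K by (simp add: adjoinedI mem_intros)
  show "x * y \<in> adjoined"
    unfolding xy quad_mult[OF refl] using K cube_mem by (intro adjoinedI) (simp_all add: mem_intros)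
next
  fix x assume "x \<in> adjoined"
  then obtain a b d where K: "a \<in> K" "b \<in> K" "d \<in> K" and x: "x = quad \<alpha> (a, b, d)"
    by (metis adjoinedE)
  define t where "t = \<alpha> ^ 3"
  \<comment> \<open>\<open>N\<close> is the norm of \<open>x\<close>, and \<open>y\<close> is the
    product of the other two conjugates expanded in 1, \<alpha>, \<alpha>^2.\<close>
  define N where "N = a ^ 3 + b ^ 3 * t + d ^ 3 * t\<^sup>2 - 3 * a * b * d * t"
  define y where "y = quad \<alpha> (a\<^sup>2 - b * d * t, d\<^sup>2 * t - a * b, b\<^sup>2 - a * d)"
  have t: "t \<in> K" using cube_mem by (simp add: t_def)
  show "inverse x \<in> adjoined"
  proof (cases "x = 0")
    case True
    then show ?thesis using adjoinedI[of 0 0 0] by (simp add: quad_def mem_intros)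
  next
    case False
    have conj: "quad (omega ^ i * \<alpha>) (a, b, d) \<noteq> 0" for i
    proof
      assume "quad (omega ^ i * \<alpha>) (a, b, d) = 0"
      then have "a + (b * omega ^ i) * \<alpha> + (d * (omega ^ i)\<^sup>2) * \<alpha>\<^sup>2 = 0"
        by (simp add: quad_def power_mult_distrib mult.assoc)
      then have "a = 0 \<and> b = 0 \<and> d = 0"
        using independent[of a "b * omega ^ i" "d * (omega ^ i)\<^sup>2"] K omega_mem omega_neq_0
        by (simp add: mem_intros)
      then show False using False x by (simp add: quad_def)
    qed
    have y: "y = quad (omega * \<alpha>) (a, b, d) * quad (omega\<^sup>2 * \<alpha>) (a, b, d)"
    proof -
      have "(omega\<^sup>2)\<^sup>2 = omega" using omega_sum by Groebner_Basis.algebra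
      then have "quad (omega * \<alpha>) (a, b, d) = a + omega * (b * \<alpha>) + omega\<^sup>2 * (d * \<alpha>\<^sup>2)"
        "quad (omega\<^sup>2 * \<alpha>) (a, b, d) = a + omega\<^sup>2 * (b * \<alpha>) + omega * (d * \<alpha>\<^sup>2)"
        by (simp_all add: quad_def power_mult_distrib mult_ac)
      then have "quad (omega * \<alpha>) (a, b, d) * quad (omega\<^sup>2 * \<alpha>) (a, b, d) =
        (a + omega * (b * \<alpha>) + omega\<^sup>2 * (d * \<alpha>\<^sup>2)) *
        (a + omega\<^sup>2 * (b * \<alpha>) + omega * (d * \<alpha>\<^sup>2))"
        by simp
      also have "\<dots> = y"
        unfolding omega_norm_form y_def t_def quad_def prod.case by Groebner_Basis.algebra
      finally show ?thesis by simp
    qed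
    have xy: "x * y = N"
      unfolding y_def x quad_def prod.case t_def N_def by Groebner_Basis.algebra
    have "N \<noteq> 0"
      unfolding xy[symmetric] y using False conj[of 1] conj[of 2] by simp
    then have "inverse x = inverse N * y"
      using xy by (auto simp: field_simps)
    also have "\<dots> = quad \<alpha> (inverse N * (a\<^sup>2 - b * d * t), inverse N * (d\<^sup>2 * t - a * b),
        inverse N * (b\<^sup>2 - a * d))"
      by (simp add: y_def quad_def algebra_simps)
    also have "\<dots> \<in> adjoined"
      unfolding N_def using K t by (intro adjoinedI mem_intros)
    finally show ?thesis .
  qed
qed

lemma subset_adjoined: "K \<subseteq> adjoined"
proof
  fix x assume "x \<in> K"
  then show "x \<in> adjoined" using adjoinedI[of x 0 0] by (simp add: quad_def mem_intros)
qed

lemma adjoined_eq_hull: "adjoined = complex_subfield hull (insert \<alpha> K)"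
proof (rule sym, rule hull_unique)
  show "insert \<alpha> K \<subseteq> adjoined"
    using subset_adjoined adjoinedI[of 0 1 0] by (simp add: quad_def mem_intros)
  show "complex_subfield adjoined" by (rule adjoined_subfield)
  fix S assume "insert \<alpha> K \<subseteq> S" "complex_subfield S"
  then interpret S: complex_subfield S by simp
  show "adjoined \<subseteq> S"
  proof
    fix x assume "x \<in> adjoined"
    then show "x \<in> S"
      using \<open>insert \<alpha> K \<subseteq> S\<close> by (auto elim!: adjoinedE simp: quad_def intro!: S.mem_intros)
  qed
qed

lemma rot_alpha: "rot \<alpha> = omega * \<alpha>"
  using rot_quad[of "(0, 1, 0)"] by (simp add: quad_def mem_intros)

lemma rot_fixes: "x \<in> K \<Longrightarrow> rot x = x"
  using rot_quad[of "(x, 0, 0)"] by (simp add: quad_def mem_intros)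

lemma rot_subfield_hom: "subfield_hom adjoined rot"
proof (intro subfield_hom.intro subfield_hom_axioms.intro adjoined_subfield)
  show "rot 1 = 1" by (simp add: rot_fixes mem_intros)
  have cube: "(omega * \<alpha>) ^ 3 = \<alpha> ^ 3" by (simp add: power_mult_distrib omega_cube)
  fix x y assume "x \<in> adjoined" "y \<in> adjoined"
  then obtain a b d a' b' d' where K: "a \<in> K" "b \<in> K" "d \<in> K" "a' \<in> K" "b' \<in> K" "d' \<in> K"
    and xy: "x = quad \<alpha> (a, b, d)" "y = quad \<alpha> (a', b', d')"
    by (metis adjoinedE)
  have "x + y = quad \<alpha> (a + a', b + b', d + d')"
    by (simp add: xy quad_def algebra_simps)
  then show "rot (x + y) = rot x + rot y"
    using K by (simp add: xy rot_quad mem_intros) (simp add: quad_def algebra_simps)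
  show "rot (x * y) = rot x * rot y"
    using K cube_mem
    by (simp add: xy rot_quad mem_intros quad_mult[of \<alpha> "\<alpha> ^ 3"] quad_mult[OF cube] del: power_mult_distrib)
qed

lemma rot_mem_Gal: "rot \<in> carrier (Gal adjoined)"
proof -
  have "rot ` adjoined \<subseteq> adjoined"
    by (auto simp: adjoined_def rot_quad) (auto simp flip: adjoined_def intro!: quad_rot_mem)
  moreover have "x \<in> rot ` adjoined" if "x \<in> adjoined" for x
  proof -
    obtain a b d where K: "a \<in> K" "b \<in> K" "d \<in> K" and x: "x = quad \<alpha> (a, b, d)"
      using \<open>x \<in> adjoined\<close> by (rule adjoinedE)
    have "omega\<^sup>2 * omega = 1" "omega * omega\<^sup>2 = 1"
      using omega_cube by (simp_all add: power3_eq_cube power2_eq_square mult.assoc)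
    \<comment> \<open>\<open>rot\<close> scales the last two coordinates by \<open>omega\<close> and
      \<open>omega^2\<close>; the preimage undoes this with the inverse factors.\<close>
    then have "x = quad (omega * \<alpha>) (a, omega\<^sup>2 * b, omega * d)"
      unfolding x quad_def prod.case by Groebner_Basis.algebra
    also have "\<dots> = rot (quad \<alpha> (a, omega\<^sup>2 * b, omega * d))"
      using K omega_mem by (simp add: rot_quad mem_intros)
    finally show ?thesis using K omega_mem by (auto intro!: adjoinedI mem_intros)
  qed
  ultimately show ?thesis
    unfolding mem_Gal_iff[OF adjoined_subfield]
    using rot_subfield_hom by (auto simp: rot_def)
qed

text \<open>An element with cube in \<open>K\<close> is an eigenvector of \<open>rot\<close>, hence lies in one of the
  eigenspaces \<open>K\<close>, \<open>K \<alpha>\<close>, \<open>K \<alpha>\<^sup>2\<close>.\<close>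

lemma cube_mem_cases:
  assumes "x \<in> adjoined" "x ^ 3 \<in> K"
  obtains i a where "i \<in> {0, 1, 2 :: nat}" "a \<in> K" "x = a * \<alpha> ^ i"
proof -
  interpret r: subfield_hom adjoined rot by (rule rot_subfield_hom)
  obtain a b d where K: "a \<in> K" "b \<in> K" "d \<in> K" and x: "x = quad \<alpha> (a, b, d)"
    using assms(1) by (rule adjoinedE)
  have "rot x ^ 3 = x ^ 3"
    using assms by (simp flip: r.hom_power add: rot_fixes)
  then obtain i where i: "i \<in> {0, 1, 2 :: nat}" "rot x = omega ^ i * x"
    by (rule cube_eq_cases)
  have "(a - omega ^ i * a) + (b * omega - omega ^ i * b) * \<alpha> + (d * omega\<^sup>2 - omega ^ i * d) * \<alpha>\<^sup>2 = 0"
    using i(2) K unfolding x by (simp add: rot_quad) (simp add: quad_def algebra_simps)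
  then have "a - omega ^ i * a = 0 \<and> b * omega - omega ^ i * b = 0 \<and> d * omega\<^sup>2 - omega ^ i * d = 0"
    using K omega_mem by (intro independent) (auto simp: mem_intros)
  then have "a * (1 - omega ^ i) = 0" "b * (omega - omega ^ i) = 0" "d * (omega\<^sup>2 - omega ^ i) = 0"
    by (simp_all add: algebra_simps)
  \<comment> \<open>The eigenvalues 1, \<open>omega\<close>, \<open>omega^2\<close> are distinct, so
    two of the three coordinates vanish.\<close>
  then have "x = a * \<alpha> ^ 0 \<or> x = b * \<alpha> ^ 1 \<or> x = d * \<alpha> ^ 2"
    using i(1) omega_neq_1 omega_sq_neq_1 omega_sq_neq unfolding x by (auto simp: quad_def)
  then show thesis using K that[of 0 a] that[of 1 b] that[of 2 d] by auto
qed

end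

section \<open>The action on the generators\<close>

text \<open>Parameters need not be unique and \<open>A\<close> carries no group structure. A choice
  \<open>p\<close> of parameters followed by \<psi> is well behaved because \<psi> identifies
  exactly the parameters of equal elements.\<close>

lemma iso_by_parameters:
  fixes G :: "('g, 'x) monoid_scheme" and H :: "('h, 'y) monoid_scheme"
  assumes total: "\<And>g. g \<in> carrier G \<Longrightarrow> \<exists>t\<in>A. R t g"
    and exists: "\<And>t. t \<in> A \<Longrightarrow> \<exists>g\<in>carrier G. R t g"
    and comp: "\<And>t t' g g'. \<lbrakk>t \<in> A; t' \<in> A; g \<in> carrier G; g' \<in> carrier G; R t g; R t' g'\<rbrakk>
      \<Longrightarrow> m t t' \<in> A \<and> g \<otimes>\<^bsub>G\<^esub> g' \<in> carrier G \<and> R (m t t') (g \<otimes>\<^bsub>G\<^esub> g')"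
    and eq: "\<And>t t' g g'. \<lbrakk>t \<in> A; t' \<in> A; g \<in> carrier G; g' \<in> carrier G; R t g; R t' g'\<rbrakk>
      \<Longrightarrow> g = g' \<longleftrightarrow> \<psi> t = \<psi> t'"
    and surj: "\<psi> ` A = carrier H"
    and hom: "\<And>t t'. t \<in> A \<Longrightarrow> t' \<in> A \<Longrightarrow> \<psi> (m t t') = \<psi> t \<otimes>\<^bsub>H\<^esub> \<psi> t'"
  shows "G \<cong> H"
proof -
  obtain p where p: "\<And>g. g \<in> carrier G \<Longrightarrow> p g \<in> A \<and> R (p g) g"
    using total by metis
  have "bij_betw (\<psi> \<circ> p) (carrier G) (carrier H)"
  proof (rule bij_betwI')
    fix g g' assume "g \<in> carrier G" "g' \<in> carrier G"
    then show "((\<psi> \<circ> p) g = (\<psi> \<circ> p) g') = (g = g')" using p eq by (metis comp_apply)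
  next
    fix g assume "g \<in> carrier G"
    then show "(\<psi> \<circ> p) g \<in> carrier H" using p surj by auto
  next
    fix h assume "h \<in> carrier H"
    then obtain t where t: "t \<in> A" "h = \<psi> t" using surj by blast
    then obtain g where "g \<in> carrier G" "R t g" using exists by blast
    then show "\<exists>g\<in>carrier G. h = (\<psi> \<circ> p) g" using t p eq by (metis comp_apply)
  qed
  moreover have "(\<psi> \<circ> p) (g \<otimes>\<^bsub>G\<^esub> g') = (\<psi> \<circ> p) g \<otimes>\<^bsub>H\<^esub> (\<psi> \<circ> p) g'"
    if "g \<in> carrier G" "g' \<in> carrier G" for g g'
  proof -
    note * = comp[OF conjunct1[OF p] conjunct1[OF p] that conjunct2[OF p] conjunct2[OF p]]
    \<comment> \<open>The chosen parameter of the product and the product of the chosen parameters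
      describe the same element.\<close>
    have "\<psi> (p (g \<otimes>\<^bsub>G\<^esub> g')) = \<psi> (m (p g) (p g'))"
      using eq[of "p (g \<otimes>\<^bsub>G\<^esub> g')" "m (p g) (p g')" "g \<otimes>\<^bsub>G\<^esub> g'" "g \<otimes>\<^bsub>G\<^esub> g'"] * p that
      by blast
    then show ?thesis using hom p that by simp
  qed
  ultimately have "\<psi> \<circ> p \<in> iso G H"
    using p surj by (auto simp: iso_def hom_def)
  then show ?thesis unfolding is_iso_def by blast
qed

definition gens_field :: "complex \<Rightarrow> complex \<Rightarrow> complex set" where
  "gens_field z c = complex_subfield hull {omega, z, c}"

text \<open>In the value at \<open>z\<close> the sign stands outside the factor
  \<open>omega powi j\<close>. Composition then adds the \<open>j\<close> without a twist, whereas
  the \<open>k\<close> of the inner map is multiplied by the outer sign.\<close>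

fun acts :: "complex \<Rightarrow> complex \<Rightarrow> int \<times> int \<times> int \<Rightarrow> (complex \<Rightarrow> complex) \<Rightarrow> bool" where
  "acts z c (e, j, k) \<sigma> \<longleftrightarrow>
    \<sigma> omega = omega powi e \<and> \<sigma> z = (omega powi j * z) powi e \<and> \<sigma> c = omega powi k * c"

fun param_mult :: "int \<times> int \<times> int \<Rightarrow> int \<times> int \<times> int \<Rightarrow> int \<times> int \<times> int" where
  "param_mult (e, j, k) (e', j', k') = (e * e', j + j', k + e * k')"

fun param_cong :: "int \<times> int \<times> int \<Rightarrow> int \<times> int \<times> int \<Rightarrow> bool" where
  "param_cong (e, j, k) (e', j', k') \<longleftrightarrow> e = e' \<and> j mod 3 = j' mod 3 \<and> k mod 3 = k' mod 3"

lemma subfield_gens_field: "complex_subfield (gens_field z c)"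
  unfolding gens_field_def by (rule complex_subfield_hull)

lemma gens_mem: "omega \<in> gens_field z c" "z \<in> gens_field z c" "c \<in> gens_field z c"
  unfolding gens_field_def by (auto intro: hull_inc)

lemma gens_field_minimal:
  "complex_subfield S \<Longrightarrow> omega \<in> S \<Longrightarrow> z \<in> S \<Longrightarrow> c \<in> S \<Longrightarrow> gens_field z c \<subseteq> S"
  unfolding gens_field_def by (rule hull_minimal) auto

lemma Gal_gens_hom: "\<sigma> \<in> carrier (Gal (gens_field z c)) \<Longrightarrow> subfield_hom (gens_field z c) \<sigma>"
  by (simp add: mem_Gal_iff subfield_gens_field)

lemma acts_param_cong: "param_cong t t' \<Longrightarrow> acts z c t \<sigma> \<Longrightarrow> acts z c t' \<sigma>"
  by (cases t; cases t') (auto simp flip: omega_powi_eq_iff)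

lemma acts_determines:
  assumes "\<sigma> \<in> carrier (Gal (gens_field z c))" "\<tau> \<in> carrier (Gal (gens_field z c))"
    and "acts z c t \<sigma>" "acts z c t \<tau>"
  shows "\<sigma> = \<tau>"
proof (rule extensionalityI)
  show "\<sigma> \<in> extensional (gens_field z c)" "\<tau> \<in> extensional (gens_field z c)"
    using assms by (simp_all add: mem_Gal_iff subfield_gens_field)
  have "gens_field z c \<subseteq> {x \<in> gens_field z c. \<sigma> x = \<tau> x}"
    using assms gens_mem complex_subfield_equalizer[OF Gal_gens_hom Gal_gens_hom]
    by (intro gens_field_minimal) (cases t; auto)+
  then show "\<sigma> x = \<tau> x" if "x \<in> gens_field z c" for x using that by blast
qed

lemma acts_mult:
  assumes \<sigma>: "\<sigma> \<in> carrier (Gal (gens_field z c))" and \<tau>: "\<tau> \<in> carrier (Gal (gens_field z c))"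
    and acts: "acts z c t \<sigma>" "acts z c t' \<tau>"
  shows "acts z c (param_mult t t') (\<sigma> \<otimes>\<^bsub>Gal (gens_field z c)\<^esub> \<tau>)"
proof -
  obtain e j k e' j' k' where t: "t = (e, j, k)" "t' = (e', j', k')" by (metis prod_cases3)
  interpret subfield_hom "gens_field z c" \<sigma> using \<sigma> by (rule Gal_gens_hom)
  note hom = hom_power_int hom_mult power_int_mem mult_mem gens_mem
  have "\<sigma> (\<tau> omega) = omega powi (e * e')"
    using acts by (simp add: t hom power_int_mult)
  moreover have "\<sigma> (\<tau> z) = ((omega powi e) powi j' * (omega powi j * z) powi e) powi e'"
    using acts by (simp add: t hom)
  then have "\<sigma> (\<tau> z) = (omega powi (j + j') * z) powi (e * e')"
    by (simp add: power_int_add omega_neq_0 power_int_mult_distrib mult_ac flip: power_int_mult)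
  moreover have "\<sigma> (\<tau> c) = omega powi (k + e * k') * c"
    using acts by (simp add: t hom power_int_add omega_neq_0 power_int_mult)
  ultimately show ?thesis
    using gens_mem by (simp add: t Gal_mult[OF \<sigma> \<tau>] compose_eq)
qed

lemma acts_unique:
  assumes "z \<noteq> 0" "c \<noteq> 0" "acts z c t \<sigma>" "acts z c t' \<sigma>" "fst t \<in> {1, - 1}" "fst t' \<in> {1, - 1}"
  shows "param_cong t t'"
proof -
  obtain e j k e' j' k' where t: "t = (e, j, k)" "t' = (e', j', k')" by (metis prod_cases3)
  have "e mod 3 = e' mod 3"
    using assms by (simp add: t flip: omega_powi_eq_iff)
  then have e: "e = e'" using assms(5,6) by (auto simp: t)
  have "(omega powi j * z) powi e = (omega powi j' * z) powi e"
    using assms by (simp add: t e)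
  then have "omega powi j * z = omega powi j' * z"
    using assms(5) by (auto simp: t power_int_minus)
  then have "omega powi j = omega powi j'" "omega powi k = omega powi k'"
    using assms by (simp_all add: t)
  then show ?thesis by (simp add: t e omega_powi_eq_iff)
qed

text \<open>The image of \<open>omega\<close> is again a root of \<open>x^2 + x + 1\<close>, and the
  cubes of the images of \<open>z\<close> and \<open>c\<close> are known, so
  \<open>cube_eq_cases\<close> leaves three choices for each. A generator equal to 1 is fixed, which
  gives parameter 0.\<close>

lemma acts_total:
  assumes \<sigma>: "\<sigma> \<in> carrier (Gal (gens_field z c))"
    and z: "z ^ 3 = omega \<or> z = 1" and c: "c ^ 3 \<in> \<rat>"
  shows "\<exists>e j k. e \<in> {1, - 1} \<and> (z = 1 \<longrightarrow> j = 0) \<and> (c = 1 \<longrightarrow> k = 0) \<and> acts z c (e, j, k) \<sigma>"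
proof -
  interpret subfield_hom "gens_field z c" \<sigma> using \<sigma> by (rule Gal_gens_hom)
  have "(\<sigma> omega)\<^sup>2 + \<sigma> omega + 1 = \<sigma> (omega\<^sup>2 + omega + 1)"
    by (simp only: hom_add hom_power hom_one gens_mem mem_intros)
  then have *: "(\<sigma> omega)\<^sup>2 + \<sigma> omega + 1 = 0" by (simp add: omega_sum hom_zero)
  have "(\<sigma> omega - omega) * (\<sigma> omega - omega\<^sup>2) = 0"
    using * omega_sum by Groebner_Basis.algebra
  moreover have "omega powi (- 1) = omega powi 2"
    by (subst omega_powi_eq_iff) simp
  ultimately have "\<sigma> omega = omega powi 1 \<or> \<sigma> omega = omega powi (- 1)" by auto
  then obtain e :: int where e: "e \<in> {1, - 1}" "\<sigma> omega = omega powi e" by blast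
  have "\<exists>k. (c = 1 \<longrightarrow> k = 0) \<and> \<sigma> c = omega powi k * c"
  proof (cases "c = 1")
    case False
    have "\<sigma> c ^ 3 = c ^ 3"
      using subfield_hom_fixes_Rats[OF subfield_hom_axioms c] by (simp add: gens_mem hom_power)
    then obtain i where "\<sigma> c = omega ^ i * c" by (rule cube_eq_cases)
    then show ?thesis using False by (intro exI[of _ "int i"]) simp
  qed (simp add: hom_one)
  moreover have "\<exists>j. (z = 1 \<longrightarrow> j = 0) \<and> \<sigma> z = (omega powi j * z) powi e"
  proof (cases "z = 1")
    case False
    have "\<sigma> z ^ 3 = \<sigma> (z ^ 3)" by (simp add: gens_mem hom_power)
    also have "\<dots> = (z ^ 3) powi e" using z False e by simp
    also have "\<dots> = (z powi e) ^ 3" by (simp add: power_int_power power_int_power' mult.commute)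
    finally obtain i where i: "\<sigma> z = omega ^ i * z powi e" by (rule cube_eq_cases)
    \<comment> \<open>The factor moves inside the sign by taking \<open>j = i e\<close>, as
      \<open>e * e = 1\<close>.\<close>
    have "omega ^ i = (omega powi (int i * e)) powi e"
      using e(1) by (auto simp: power_int_minus)
    then show ?thesis
      using False i by (intro exI[of _ "int i * e"]) (simp add: power_int_mult_distrib)
  qed (simp add: hom_one)
  ultimately show ?thesis using e by auto
qed

text \<open>Stated with \<alpha> and \<beta> so that it applies both to \<open>z\<close> over the
  field of \<open>c\<close> and to \<open>c\<close> over the field of \<open>z\<close>.\<close>

lemma exists_acts_adjoin:
  assumes gens: "{omega, z, c} = insert \<alpha> {omega, \<beta>}" and "\<alpha> \<notin> complex_subfield hull {omega, \<beta>}"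
    and "\<alpha> ^ 3 \<in> complex_subfield hull {omega, \<beta>}"
  shows "\<exists>\<sigma>\<in>carrier (Gal (gens_field z c)). \<sigma> omega = omega \<and> \<sigma> \<beta> = \<beta> \<and> \<sigma> \<alpha> = omega * \<alpha>"
proof -
  let ?K = "complex_subfield hull {omega, \<beta>}"
  have mem: "omega \<in> ?K" "\<beta> \<in> ?K" by (auto intro: hull_inc)
  interpret complex_subfield ?K by (rule complex_subfield_hull)
  interpret pure_cubic ?K \<alpha>
    by unfold_locales (use assms mem in auto)
  have "adjoined = gens_field z c"
    unfolding adjoined_eq_hull gens_field_def gens by (rule hull_insert[symmetric])
  then show ?thesis
    using rot_mem_Gal rot_alpha rot_fixes mem by metis
qed

text \<open>Taking \<open>z = 1\<close> or \<open>c = 1\<close> removes the corresponding generator; its parameter is then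
  normalised to 0.\<close>

lemma Gal_gens_field_iso:
  fixes z c :: complex and H :: "('h, 'y) monoid_scheme" and \<psi> :: "int \<times> int \<times> int \<Rightarrow> 'h"
  defines "L \<equiv> gens_field z c"
    and "A \<equiv> {(e, j, k). e \<in> {1, - 1} \<and> (z = 1 \<longrightarrow> j = 0) \<and> (c = 1 \<longrightarrow> k = 0)}"
  assumes z: "z ^ 3 = omega \<or> z = 1" "z \<noteq> 1 \<Longrightarrow> z \<notin> complex_subfield hull {omega, c}"
      "cnj z = z powi (- 1)"
    and c: "c ^ 3 \<in> \<rat>" "c \<noteq> 1 \<Longrightarrow> c \<notin> complex_subfield hull {omega, z}" "cnj c = c" "c \<noteq> 0"
    and surj: "\<psi> ` A = carrier H"
    and hom: "\<And>t t'. t \<in> A \<Longrightarrow> t' \<in> A \<Longrightarrow> \<psi> (param_mult t t') = \<psi> t \<otimes>\<^bsub>H\<^esub> \<psi> t'"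
    and eq: "\<And>t t'. t \<in> A \<Longrightarrow> t' \<in> A \<Longrightarrow> \<psi> t = \<psi> t' \<longleftrightarrow> param_cong t t'"
  shows "Gal L \<cong> H"
proof (rule iso_by_parameters[where R = "acts z c" and m = param_mult and \<psi> = \<psi> and A = A])
  interpret L: complex_subfield L unfolding L_def by (rule subfield_gens_field)
  have z0: "z \<noteq> 0" using z(1) omega_neq_0 by auto
  interpret G: group "Gal L" by (rule group_Gal) (rule L.complex_subfield_axioms)
  define realised where "realised t \<longleftrightarrow> (\<exists>g\<in>carrier (Gal L). acts z c t g)" for t
  have realised_mult: "realised (param_mult t t')" if "realised t" "realised t'" for t t'
  proof -
    obtain g g' where g: "g \<in> carrier (Gal L)" "acts z c t g" "g' \<in> carrier (Gal L)" "acts z c t' g'"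
      using \<open>realised t\<close> \<open>realised t'\<close> unfolding realised_def by blast
    show ?thesis
      unfolding realised_def
    proof (rule bexI)
      show "acts z c (param_mult t t') (g \<otimes>\<^bsub>Gal L\<^esub> g')"
        using acts_mult[OF g(1,3)[unfolded L_def] g(2,4)] by (simp add: L_def)
      show "g \<otimes>\<^bsub>Gal L\<^esub> g' \<in> carrier (Gal L)" by (rule G.m_closed[OF g(1,3)])
    qed
  qed
  have realised_cong: "realised t'" if "realised t" "param_cong t t'" for t t'
    using that acts_param_cong unfolding realised_def by blast
  \<comment> \<open>The preimage of \<open>L\<close> under conjugation is a subfield, so checking
    the generators shows that \<open>L\<close> is stable.\<close>
  have "complex_subfield (cnj -` L)"
    by unfold_locales (auto simp: L.mem_intros)
  then have "L \<subseteq> cnj -` L"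
    unfolding L_def
    by (rule gens_field_minimal)
      (simp_all add: cnj_omega z(3) c(3) gens_mem complex_subfield.inverse_mem[OF subfield_gens_field])
  then have "cnj ` L \<subseteq> L" by blast
  then have "restrict cnj L \<in> carrier (Gal L)"
    by (rule cnj_mem_Gal[OF L.complex_subfield_axioms])
  moreover have "acts z c (- 1, 0, 0) (restrict cnj L)"
    by (simp add: L_def gens_mem cnj_omega z(3) c(3))
  ultimately have r_cnj: "realised (- 1, 0, 0)" unfolding realised_def by blast
  from realised_mult[OF r_cnj r_cnj] have r_id: "realised (1, 0, 0)" by simp
  have r_z: "realised (1, 1, 0)" if "z \<noteq> 1"
  proof -
    have "omega \<in> complex_subfield hull {omega, c}" by (auto intro: hull_inc)
    then have "z ^ 3 \<in> complex_subfield hull {omega, c}" using z(1) that by simp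
    then have "\<exists>\<sigma>\<in>carrier (Gal (gens_field z c)). \<sigma> omega = omega \<and> \<sigma> c = c \<and> \<sigma> z = omega * z"
      using z(2)[OF that] by (intro exists_acts_adjoin) auto
    then show ?thesis unfolding realised_def L_def by auto
  qed
  have r_c: "realised (1, 0, 1)" if "c \<noteq> 1"
  proof -
    have "c ^ 3 \<in> complex_subfield hull {omega, z}"
      using c(1) complex_subfield.Rats_subset[OF complex_subfield_hull] by blast
    then have "\<exists>\<sigma>\<in>carrier (Gal (gens_field z c)). \<sigma> omega = omega \<and> \<sigma> z = z \<and> \<sigma> c = omega * c"
      using c(2)[OF that] by (intro exists_acts_adjoin) auto
    then show ?thesis unfolding realised_def L_def by auto
  qed
  show "\<exists>g\<in>carrier (Gal L). acts z c t g" if "t \<in> A" for t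
  proof -
    obtain e j k where t: "t = (e, j, k)" and e: "e \<in> {1, - 1}" and jk: "z = 1 \<Longrightarrow> j = 0" "c = 1 \<Longrightarrow> k = 0"
      using \<open>t \<in> A\<close> unfolding A_def by blast
    have "realised (1, j, 0)"
    proof (cases "z = 1")
      case False
      have "j mod 3 = 0 \<or> j mod 3 = 1 \<or> j mod 3 = 2" by presburger
      then show ?thesis
      proof (elim disjE)
        assume "j mod 3 = 0"
        then show ?thesis using realised_cong[OF r_id] by simp
      next
        assume "j mod 3 = 1"
        then show ?thesis using realised_cong[OF r_z[OF False]] by simp
      next
        assume "j mod 3 = 2"
        then show ?thesis
          using realised_cong[OF realised_mult[OF r_z[OF False] r_z[OF False]]] by simp
      qed
    qed (simp add: jk r_id)
    moreover have "realised (1, 0, k)"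
    proof (cases "c = 1")
      case False
      have "k mod 3 = 0 \<or> k mod 3 = 1 \<or> k mod 3 = 2" by presburger
      then show ?thesis
      proof (elim disjE)
        assume "k mod 3 = 0"
        then show ?thesis using realised_cong[OF r_id] by simp
      next
        assume "k mod 3 = 1"
        then show ?thesis using realised_cong[OF r_c[OF False]] by simp
      next
        assume "k mod 3 = 2"
        then show ?thesis
          using realised_cong[OF realised_mult[OF r_c[OF False] r_c[OF False]]] by simp
      qed
    qed (simp add: jk r_id)
    moreover have "realised (e, 0, 0)" using e r_id r_cnj by auto
    \<comment> \<open>The sign factor stands rightmost; further left it would turn \<open>k\<close>
      into \<open>e * k\<close>.\<close>
    ultimately have "realised (param_mult (1, j, 0) (param_mult (1, 0, k) (e, 0, 0)))"
      by (intro realised_mult)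
    then show ?thesis by (simp add: t realised_def)
  qed
  show "\<exists>t\<in>A. acts z c t g" if "g \<in> carrier (Gal L)" for g
  proof -
    have "g \<in> carrier (Gal (gens_field z c))" using that by (simp add: L_def)
    from acts_total[OF this z(1) c(1)] show ?thesis unfolding A_def by blast
  qed
  show "\<psi> (param_mult t t') = \<psi> t \<otimes>\<^bsub>H\<^esub> \<psi> t'" if "t \<in> A" "t' \<in> A" for t t'
    using that by (rule hom)
  fix t t' g g'
  assume *: "t \<in> A" "t' \<in> A" "g \<in> carrier (Gal L)" "g' \<in> carrier (Gal L)" "acts z c t g" "acts z c t' g'"
  have "param_mult t t' \<in> A" using *(1,2) by (auto simp: A_def)
  then show "param_mult t t' \<in> A \<and> g \<otimes>\<^bsub>Gal L\<^esub> g' \<in> carrier (Gal L) \<and>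
      acts z c (param_mult t t') (g \<otimes>\<^bsub>Gal L\<^esub> g')"
    using acts_mult[OF *(3,4)[unfolded L_def] *(5,6)] G.m_closed[OF *(3,4)] by (simp add: L_def)
  have fst: "fst t \<in> {1, - 1}" "fst t' \<in> {1, - 1}" using *(1,2) by (auto simp: A_def)
  have "g = g' \<longleftrightarrow> param_cong t t'"
  proof
    assume "g = g'"
    then show "param_cong t t'" using acts_unique[OF z0 c(4) *(5) _ fst] *(6) by simp
  next
    assume "param_cong t t'"
    then have "acts z c t' g" using acts_param_cong *(5) by blast
    then show "g = g'" using acts_determines *(3,4,6) unfolding L_def by blast
  qed
  then show "g = g' \<longleftrightarrow> \<psi> t = \<psi> t'" using eq * by simp
qed (rule surj)

section \<open>Affine permutations of three letters\<close>

text \<open>The permutation of the roots \<open>\<omega>\<^sup>i c\<close> of \<open>x\<^sup>3 - c\<^sup>3\<close>, indexed by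
  \<open>i = 1, 2, 3\<close>.\<close>

definition affine_perm :: "int \<Rightarrow> int \<Rightarrow> nat \<Rightarrow> nat" where
  "affine_perm e k i = (if 1 \<le> i \<and> i \<le> 3 then nat ((e * int i + k - 1) mod 3) + 1 else i)"

lemma affine_perm_comp:
  "affine_perm e k \<circ> affine_perm e' k' = affine_perm (e * e') (k + e * k')"
proof
  fix i
  show "(affine_perm e k \<circ> affine_perm e' k') i = affine_perm (e * e') (k + e * k') i"
  proof (cases "1 \<le> i \<and> i \<le> 3")
    case True
    \<comment> \<open>The inner map reaches the letter \<open>1 + x mod 3\<close>.\<close>
    define x where "x = e' * int i + k' - 1"
    have x: "0 \<le> x mod 3" "x mod 3 < 3" by simp_all
    have "(e * (1 + x mod 3) + k - 1) mod 3 = (e * (x mod 3) + (e + k - 1)) mod 3"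
      by (simp add: algebra_simps)
    also have "\<dots> = (e * x + (e + k - 1)) mod 3"
      by (metis mod_add_left_eq mod_mult_right_eq)
    also have "e * x + (e + k - 1) = e * e' * int i + (k + e * k') - 1"
      by (simp add: x_def algebra_simps)
    finally show ?thesis
      using True x by (simp add: affine_perm_def x_def[symmetric] nat_le_iff)
  next
    case False
    then have "affine_perm a b i = i" for a b by (auto simp: affine_perm_def)
    then show ?thesis by simp
  qed
qed

lemma affine_perm_1_0: "affine_perm 1 0 = id"
proof
  fix i :: nat
  have "i = 1 \<or> i = 2 \<or> i = 3" if "1 \<le> i \<and> i \<le> 3" using that by presburger
  then show "affine_perm 1 0 i = id i" by (auto simp: affine_perm_def)
qed

lemma affine_perm_permutes:
  assumes "e \<in> {1, - 1}"
  shows "affine_perm e k permutes {1..3}"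
proof -
  have "bij (affine_perm e k)"
    \<comment> \<open>The inverse of \<open>i \<mapsto> e i + k\<close> is
      \<open>i \<mapsto> e i - e k\<close>, because \<open>e * e = 1\<close>.\<close>
    by (rule o_bij[of "affine_perm e (- e * k)"])
      (use assms in \<open>auto simp: affine_perm_comp affine_perm_1_0\<close>)
  then show ?thesis
    unfolding permutes_def bij_iff by (auto simp: affine_perm_def)
qed

lemma affine_perm_eq_iff:
  assumes "e \<in> {1, - 1}" "e' \<in> {1, - 1}"
  shows "affine_perm e k = affine_perm e' k' \<longleftrightarrow> e = e' \<and> k mod 3 = k' mod 3"
proof
  assume eq: "affine_perm e k = affine_perm e' k'"
  have dvd: "3 dvd (e * int i + k - 1) - (e' * int i + k' - 1)" if "1 \<le> i \<and> i \<le> 3" for i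
  proof -
    have "nat ((e * int i + k - 1) mod 3) + 1 = nat ((e' * int i + k' - 1) mod 3) + 1"
      using fun_cong[OF eq, of i] that by (simp only: affine_perm_def simp_thms if_True)
    then show ?thesis
      by (simp only: add_right_cancel eq_nat_nat_iff pos_mod_sign zero_less_numeral
          flip: mod_eq_dvd_iff)
  qed
  have "3 dvd (e * 1 + k - 1) - (e' * 1 + k' - 1)" "3 dvd (e * 3 + k - 1) - (e' * 3 + k' - 1)"
    using dvd[of 1] dvd[of 3] by simp_all
  then obtain u v where u: "(e * 1 + k - 1) - (e' * 1 + k' - 1) = 3 * u"
    and v: "(e * 3 + k - 1) - (e' * 3 + k' - 1) = 3 * v"
    unfolding dvd_def by blast
  \<comment> \<open>Subtracting the equations for the letters 1 and 3 gives
    \<open>2 (e - e') = 3 (v - u)\<close>; distinct signs differ by 2, which 3 does not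
    divide.\<close>
  have "e - e' = 3 * (u - v + e - e')" using u v by Groebner_Basis.algebra
  then have "3 dvd e - e'" by (rule dvdI)
  then have e: "e = e'" using assms by (elim insertE emptyE) simp_all
  then have "k - k' = 3 * v" using v by linarith
  then show "e = e' \<and> k mod 3 = k' mod 3" using e by (simp add: mod_eq_dvd_iff)
next
  assume *: "e = e' \<and> k mod 3 = k' mod 3"
  have "(e * int i + k - 1) mod 3 = (e * int i + k' - 1) mod 3" for i
  proof -
    have "(e * int i + k - 1) - (e * int i + k' - 1) = k - k'" by simp
    then show ?thesis using * by (simp only: mod_eq_dvd_iff)
  qed
  then show "affine_perm e k = affine_perm e' k'"
    using * by (simp only: affine_perm_def fun_eq_iff simp_thms)
qed

text \<open>By counting: two signs and three residues give six distinct permutations, and the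
  symmetric group has 3! = 6 elements.\<close>

lemma affine_perm_surj:
  "(\<lambda>(e, k). affine_perm e k) ` ({1, - 1} \<times> UNIV) = carrier (sym_group 3)"
proof -
  let ?f = "\<lambda>(e, k). affine_perm e k" and ?T = "{1, - 1} \<times> {0, 1, 2 :: int}"
  have sub: "?f ` ({1, - 1} \<times> UNIV) \<subseteq> carrier (sym_group 3)"
    using affine_perm_permutes by (auto simp: sym_group_carrier)
  have "inj_on ?f ?T"
    by (rule inj_onI) (auto simp: affine_perm_eq_iff)
  then have "card (?f ` ?T) = 6"
    by (subst card_image) simp_all
  moreover have fin: "finite (carrier (sym_group 3))"
    by (rule card_ge_0_finite) (simp add: sym_group_card_carrier)
  ultimately have "?f ` ?T = carrier (sym_group 3)"
    using sub by (intro card_subset_eq) (auto simp: sym_group_card_carrier fact_numeral)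
  then show ?thesis using sub by blast
qed

section \<open>Irrationalities\<close>

text \<open>A rational algebraic integer is an integer. The form without quadratic term covers both
  \<open>y^3 - 3 y + 1\<close> and \<open>x^3 - q\<close>.\<close>

lemma rational_root_cubic:
  fixes x :: complex
  assumes "x \<in> \<rat>" and eq: "x ^ 3 + of_int a * x + of_int b = 0"
  obtains n :: int where "x = of_int n" "n ^ 3 + a * n + b = 0"
proof -
  have "algebraic_int x"
  proof (rule algebraic_int.intros)
    show "poly [:of_int b, of_int a, 0, 1:] x = 0"
      using eq by (simp add: power3_eq_cube algebra_simps)
    show "\<forall>i. coeff [:of_int b, of_int a, 0, 1:] i \<in> \<int>"
      by (auto simp: coeff_pCons split: nat.splits)
  qed simp
  then obtain n where n: "x = of_int n"
    using rational_algebraic_int_is_int assms(1) by (metis Ints_cases)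
  then have "of_int (n ^ 3 + a * n + b) = (0 :: complex)" using eq by simp
  then show thesis using n that by (simp only: of_int_eq_0_iff)
qed

lemma cnj_Rats: "x \<in> \<rat> \<Longrightarrow> cnj x = x"
  by (metis Rats_cases' complex_cnj_divide complex_cnj_of_int)

lemma cnj_omega_eq: "cnj omega = - omega - 1"
  by (simp add: omega_eq complex_eq_iff)

text \<open>The right-hand side is closed under inverses since \<open>x\<close> times its conjugate
  is the rational number \<open>a^2 - a b + b^2\<close>.\<close>

lemma hull_omega_subset:
  "complex_subfield hull {omega} \<subseteq> {a + b * omega | a b. a \<in> \<rat> \<and> b \<in> \<rat>}" (is "_ \<subseteq> ?E")
proof (rule hull_minimal)
  have "0 + 1 * omega \<in> ?E" using Rats_0 Rats_1 by blast
  then show "{omega} \<subseteq> ?E" by simp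
  show "complex_subfield ?E"
  proof
    have "1 + 0 * omega \<in> ?E" using Rats_0 Rats_1 by blast
    then show "1 \<in> ?E" by simp
    fix x y assume "x \<in> ?E" "y \<in> ?E"
    then obtain a b a' b' where Q: "a \<in> \<rat>" "b \<in> \<rat>" "a' \<in> \<rat>" "b' \<in> \<rat>"
      and xy: "x = a + b * omega" "y = a' + b' * omega" by blast
    have "x - y = (a - a') + (b - b') * omega" unfolding xy by Groebner_Basis.algebra
    then show "x - y \<in> ?E" using Q Rats_diff by blast
    have "x * y = (a * a' - b * b') + (a * b' + b * a' - b * b') * omega"
      unfolding xy using omega_sum by Groebner_Basis.algebra
    then show "x * y \<in> ?E" using Q by (blast intro: Rats_diff Rats_add Rats_mult)
  next
    fix x assume "x \<in> ?E"
    then obtain a b where Q: "a \<in> \<rat>" "b \<in> \<rat>" and x: "x = a + b * omega" by blast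
    define N where "N = a\<^sup>2 - a * b + b\<^sup>2"
    have "x * cnj x = N"
      using Q unfolding x N_def complex_cnj_add complex_cnj_mult cnj_omega_eq
      by (simp only: cnj_Rats) (use omega_sum in Groebner_Basis.algebra)
    then have "inverse x = cnj x / N" by (cases "x = 0") (auto simp: field_simps)
    also have "\<dots> = (a - b) / N + (- b / N) * omega"
      using Q unfolding x complex_cnj_add complex_cnj_mult cnj_omega_eq
      by (simp add: cnj_Rats diff_divide_distrib add_divide_distrib algebra_simps)
    finally have "inverse x = (a - b) / N + (- b / N) * omega" .
    moreover have "(a - b) / N \<in> \<rat>" "- b / N \<in> \<rat>"
      using Q by (simp_all add: N_def)
    ultimately show "inverse x \<in> ?E" by blast
  qed
qed

text \<open>Conjugation is the nontrivial automorphism of the field of \<open>omega\<close>, so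
  these are the norm and the trace to the rationals.\<close>

lemma hull_omega_norm_trace:
  assumes "x \<in> complex_subfield hull {omega}"
  shows "x * cnj x \<in> \<rat>" "x + cnj x \<in> \<rat>"
proof -
  obtain a b where Q: "a \<in> \<rat>" "b \<in> \<rat>" and x: "x = a + b * omega"
    using assms hull_omega_subset by blast
  have cnj: "cnj x = a + b * (- omega - 1)"
    using Q unfolding x by (simp add: cnj_Rats cnj_omega_eq)
  have "x * cnj x = a\<^sup>2 - a * b + b\<^sup>2"
    unfolding cnj unfolding x using omega_sum by Groebner_Basis.algebra
  then show "x * cnj x \<in> \<rat>" using Q by simp
  have "x + cnj x = 2 * a - b" unfolding cnj unfolding x by Groebner_Basis.algebra
  then show "x + cnj x \<in> \<rat>" using Q by simp
qed

lemma real_mem_hull_omega: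
  assumes "x \<in> complex_subfield hull {omega}" "cnj x = x"
  shows "x \<in> \<rat>"
proof -
  have "(x + cnj x) / 2 \<in> \<rat>" using hull_omega_norm_trace(2)[OF assms(1)] by simp
  then show ?thesis using assms(2) by simp
qed

lemma zeta_cnj_zeta: "zeta * cnj zeta = 1"
  by (simp add: zeta_def cis_cnj cis_mult)

text \<open>The trace \<open>2 cos (2\<pi>/9)\<close> is a root of \<open>y\<^sup>3 - 3 y + 1\<close>.\<close>

lemma zeta_not_mem_hull: "zeta \<notin> complex_subfield hull {omega}"
proof
  assume zeta: "zeta \<in> complex_subfield hull {omega}"
  define y where "y = zeta + cnj zeta"
  have "cnj zeta ^ 3 = - omega - 1"
    by (simp flip: complex_cnj_power add: zeta_cube cnj_omega_eq)
  \<comment> \<open>As \<open>zeta * cnj zeta = 1\<close>, expanding \<open>y^3\<close> gives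
    \<open>zeta^3 + cnj zeta^3 + 3 y\<close>, and the two cubes sum to -1.\<close>
  then have "y ^ 3 - 3 * y + 1 = 0"
    using zeta_cube zeta_cnj_zeta unfolding y_def by Groebner_Basis.algebra
  then have "y ^ 3 + of_int (- 3) * y + of_int 1 = 0" by simp
  moreover have "y \<in> \<rat>" unfolding y_def using hull_omega_norm_trace(2)[OF zeta] .
  ultimately obtain n :: int where "n ^ 3 + (- 3) * n + 1 = 0"
    using rational_root_cubic by metis
  \<comment> \<open>Factored this way, the equation forces \<open>n\<close> to be a unit.\<close>
  then have n: "n * (3 - n\<^sup>2) = 1" by (simp add: power3_eq_cube power2_eq_square algebra_simps)
  then have "n = 1 \<or> n = - 1" using zmult_eq_1_iff by blast
  then show False using n by auto
qed

section \<open>Independence of \<open>zeta\<close> and a real cube root\<close>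

locale pure_cubic_real =
  fixes c :: complex
  assumes cnj_c: "cnj c = c" and cube_c: "c ^ 3 \<in> \<rat>" and c_not_Rats: "c \<notin> \<rat>"
begin

lemma c_neq: "c \<noteq> 0" "c \<noteq> 1"
  using c_not_Rats by auto

text \<open>Otherwise \<open>c = c^3 / c^2\<close> would be rational. For real \<open>c\<close> this
  square is the squared absolute value compared in the next lemmas.\<close>

lemma square_not_Rats: "c\<^sup>2 \<notin> \<rat>"
proof
  assume "c\<^sup>2 \<in> \<rat>"
  then have "c ^ 3 / c\<^sup>2 \<in> \<rat>" using cube_c Rats_divide by blast
  then show False using c_not_Rats c_neq by (simp add: power3_eq_cube power2_eq_square)
qed

lemma c_not_mem_hull: "c \<notin> complex_subfield hull {omega}"
  using real_mem_hull_omega cnj_c c_not_Rats by blast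

text \<open>Membership would give \<open>c = a * zeta ^ i\<close> with \<open>a\<close> in the field
  of \<open>omega\<close>. Squared absolute values remove \<open>zeta\<close> and make
  \<open>c^2\<close> a norm, hence rational.\<close>

lemma c_not_mem_hull_zeta: "c \<notin> complex_subfield hull {omega, zeta}"
proof
  let ?K = "complex_subfield hull {omega}"
  have omega: "omega \<in> ?K" by (auto intro: hull_inc)
  interpret K: complex_subfield ?K by (rule complex_subfield_hull)
  interpret pure_cubic ?K zeta
    by unfold_locales (simp_all add: omega zeta_cube zeta_not_mem_hull)
  assume "c \<in> complex_subfield hull {omega, zeta}"
  then have "c \<in> adjoined"
    unfolding adjoined_eq_hull hull_insert[symmetric] by (simp add: insert_commute)
  moreover have "c ^ 3 \<in> ?K" using cube_c K.Rats_subset by blast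
  ultimately obtain i a where a: "a \<in> ?K" "c = a * zeta ^ i"
    by (rule cube_mem_cases)
  have "c\<^sup>2 = c * cnj c" by (simp add: cnj_c power2_eq_square)
  also have "\<dots> = a * cnj a * (zeta * cnj zeta) ^ i"
    by (simp add: a power_mult_distrib mult_ac)
  finally show False
    using square_not_Rats hull_omega_norm_trace(1)[OF a(1)] by (simp add: zeta_cnj_zeta)
qed

text \<open>Membership would give \<open>zeta = a * c ^ i\<close>, and squared absolute values make
  \<open>(c^2) ^ i\<close> rational. The case \<open>i = 0\<close> contradicts
  \<open>zeta_not_mem_hull\<close>, \<open>i = 1\<close> the irrationality of \<open>c^2\<close>,
  and \<open>i = 2\<close> that of \<open>c = c^4 / c^3\<close>.\<close>

lemma zeta_not_mem_hull_c: "zeta \<notin> complex_subfield hull {omega, c}"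
proof
  let ?K = "complex_subfield hull {omega}"
  have omega: "omega \<in> ?K" by (auto intro: hull_inc)
  interpret K: complex_subfield ?K by (rule complex_subfield_hull)
  interpret pure_cubic ?K c
    by unfold_locales (use omega cube_c K.Rats_subset c_not_mem_hull in auto)
  assume "zeta \<in> complex_subfield hull {omega, c}"
  then have "zeta \<in> adjoined"
    unfolding adjoined_eq_hull hull_insert[symmetric] by (simp add: insert_commute)
  moreover have "zeta ^ 3 \<in> ?K" by (simp add: zeta_cube omega)
  ultimately obtain i a where i: "i \<in> {0, 1, 2 :: nat}" and a: "a \<in> ?K" "zeta = a * c ^ i"
    by (rule cube_mem_cases)
  have "a * cnj a * (c\<^sup>2) ^ i = zeta * cnj zeta"
    by (simp add: a cnj_c power_mult_distrib power2_eq_square mult_ac)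
  then have norm: "a * cnj a * (c\<^sup>2) ^ i = 1" by (simp add: zeta_cnj_zeta)
  then have "(c\<^sup>2) ^ i = inverse (a * cnj a)"
    by (metis inverse_unique)
  then have Q: "(c\<^sup>2) ^ i \<in> \<rat>" using hull_omega_norm_trace(1)[OF a(1)] by (simp only: Rats_inverse)
  have "i \<noteq> 0" using a zeta_not_mem_hull by (metis mult.right_neutral power_0)
  moreover have "i \<noteq> 1" using Q square_not_Rats by auto
  moreover have "i \<noteq> 2"
  proof
    assume "i = 2"
    then have "(c\<^sup>2)\<^sup>2 / c ^ 3 \<in> \<rat>" using Q cube_c by (simp only: Rats_divide)
    moreover have "(c\<^sup>2)\<^sup>2 / c ^ 3 = c"
      using c_neq by (simp add: power3_eq_cube power2_eq_square)
    ultimately show False using c_not_Rats by simp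
  qed
  ultimately show False using i by simp
qed

end

lemma exists_real_cube_root:
  fixes q :: int
  obtains c :: complex where "c ^ 3 = of_int q" "cnj c = c"
proof
  show "complex_of_real (root 3 (of_int q)) ^ 3 = of_int q"
    by (simp flip: of_real_power add: odd_real_root_pow)
qed simp

section \<open>The three families\<close>

lemma hull_insert_1: "complex_subfield hull {omega, 1} = complex_subfield hull {omega}"
  using hull_redundant[OF complex_subfield.one_mem[OF complex_subfield_hull], of "{omega}"]
  by (simp add: insert_commute)

lemma zeta_neq_1: "zeta \<noteq> 1"
  using zeta_cube omega_neq_1 by auto

section \<open>Galois groups of the three generated fields\<close>

lemma Gal_sym_group_3:
  assumes "pure_cubic_real c"
  shows "Gal (gens_field 1 c) \<cong> sym_group 3"
proof -
  interpret pure_cubic_real c by fact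
  \<comment> \<open>The trivial premise \<open>1 = 1\<close> is kept so that \<open>?A\<close> is
    literally the parameter set of \<open>Gal_gens_field_iso\<close> at
    \<open>z = 1\<close>.\<close>
  let ?A = "{(e, j, k). e \<in> {1, - 1 :: int} \<and> ((1 :: complex) = 1 \<longrightarrow> j = (0 :: int)) \<and> (c = 1 \<longrightarrow> k = (0 :: int))}"
  let ?\<psi> = "\<lambda>(e, j :: int, k). affine_perm e k"
  show ?thesis
  proof (rule Gal_gens_field_iso[where \<psi> = ?\<psi>])
    have "?A = (\<lambda>(e, k). (e, 0, k)) ` ({1, - 1} \<times> UNIV)"
      using c_neq by auto
    then have "?\<psi> ` ?A = ?\<psi> ` (\<lambda>(e, k). (e, 0, k)) ` ({1, - 1} \<times> UNIV)"
      by (rule arg_cong)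
    also have "\<dots> = (\<lambda>(e, k). affine_perm e k) ` ({1, - 1} \<times> UNIV)"
      by (simp only: image_image case_prod_unfold fst_conv snd_conv)
    finally have "?\<psi> ` ?A = (\<lambda>(e, k). affine_perm e k) ` ({1, - 1} \<times> UNIV)" .
    then show "?\<psi> ` ?A = carrier (sym_group 3)" by (simp only: affine_perm_surj)
  next
    fix t t' assume "t \<in> ?A" "t' \<in> ?A"
    then obtain e k e' k' where t: "t = (e, 0, k)" "t' = (e', 0, k')" "e \<in> {1, - 1}" "e' \<in> {1, - 1}"
      by blast
    show "?\<psi> (param_mult t t') = ?\<psi> t \<otimes>\<^bsub>sym_group 3\<^esub> ?\<psi> t'"
      by (simp add: t(1,2) sym_group_mult affine_perm_comp)
    show "?\<psi> t = ?\<psi> t' \<longleftrightarrow> param_cong t t'"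
      by (simp add: t(1,2) affine_perm_eq_iff[OF t(3,4)])
  qed (simp_all add: cube_c cnj_c c_neq hull_insert_1 c_not_mem_hull)
qed

text \<open>The isomorphism \<open>(e, j) \<mapsto> 3 [e = -1] + 2 j\<close> from \<open>{1, -1} \<times> C\<^sub>3\<close> onto \<open>C\<^sub>6\<close>.\<close>

lemma sign_residue_mult:
  fixes e e' j j' :: int
  assumes "e \<in> {1, - 1}" "e' \<in> {1, - 1}"
  shows "((if e * e' = 1 then 0 else 3) + 2 * (j + j')) mod 6 =
    (((if e = 1 then 0 else 3) + 2 * j) mod 6 + ((if e' = 1 then 0 else 3) + 2 * j') mod 6) mod 6"
proof -
  have "(if e * e' = 1 then 0 else 3 :: int) mod 6 = ((if e = 1 then 0 else 3) + (if e' = 1 then 0 else 3)) mod 6"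
    using assms by auto
  from mod_add_cong[OF this refl[of "2 * (j + j') mod 6"]] show ?thesis
    unfolding mod_add_eq by (simp only: algebra_simps)
qed

text \<open>The parity of the residue determines the sign, and then halving the even difference
  leaves a congruence modulo 3.\<close>

lemma sign_residue_eq_iff:
  fixes e e' j j' :: int
  assumes "e \<in> {1, - 1}" "e' \<in> {1, - 1}"
  shows "((if e = 1 then 0 else 3) + 2 * j) mod 6 = ((if e' = 1 then 0 else 3) + 2 * j') mod 6
    \<longleftrightarrow> e = e' \<and> j mod 3 = j' mod 3"
proof -
  have "6 dvd (x + 2 * j) - (x + 2 * j') \<longleftrightarrow> 3 dvd j - j'" for x
    by presburger
  moreover have "\<not> 6 dvd (3 + 2 * j) - (0 + 2 * j')" "\<not> 6 dvd (0 + 2 * j) - (3 + 2 * j')"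
    by presburger+
  ultimately show ?thesis
    using assms unfolding mod_eq_dvd_iff by (elim insertE emptyE) simp_all
qed
lemma Gal_cyclic_6: "Gal (gens_field zeta 1) \<cong> integer_mod_group 6"
proof -
  let ?A = "{(e, j, k). e \<in> {1, - 1 :: int} \<and> (zeta = 1 \<longrightarrow> j = (0 :: int)) \<and> ((1 :: complex) = 1 \<longrightarrow> k = (0 :: int))}"
  let ?\<psi> = "\<lambda>(e :: int, j :: int, k :: int). ((if e = 1 then 0 else 3) + 2 * j) mod 6"
  show ?thesis
  proof (rule Gal_gens_field_iso[where \<psi> = ?\<psi>])
    show "?\<psi> ` ?A = carrier (integer_mod_group 6)"
    proof (intro Set.set_eqI iffI)
      fix x assume "x \<in> carrier (integer_mod_group 6)"
      then have x: "0 \<le> x" "x < 6" by (simp_all add: carrier_integer_mod_group)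
      show "x \<in> ?\<psi> ` ?A"
      proof (cases "even x")
        case True
        then obtain y where "x = 2 * y" by (rule evenE)
        then have "x = ?\<psi> (1, y, 0)" using x by simp
        then show ?thesis by (rule image_eqI) (simp add: zeta_neq_1)
      next
        case False
        then obtain y where "x = 2 * y + 1" by (rule oddE)
        \<comment> \<open>The sign -1 contributes 3, and
          \<open>2 y + 1 = 3 + 2 (y - 1)\<close>.\<close>
        then have "x = ?\<psi> (- 1, y - 1, 0)" using x by simp
        then show ?thesis by (rule image_eqI) (simp add: zeta_neq_1)
      qed
    qed (auto simp: carrier_integer_mod_group)
  next
    fix t t' assume "t \<in> ?A" "t' \<in> ?A"
    then obtain e j e' j' where t: "t = (e, j, 0)" "t' = (e', j', 0)" "e \<in> {1, - 1}" "e' \<in> {1, - 1}"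
      by blast
    show "?\<psi> (param_mult t t') = ?\<psi> t \<otimes>\<^bsub>integer_mod_group 6\<^esub> ?\<psi> t'"
      using sign_residue_mult[OF t(3,4)] by (simp only: t(1,2) param_mult.simps prod.case mult_integer_mod_group of_nat_numeral)
    show "?\<psi> t = ?\<psi> t' \<longleftrightarrow> param_cong t t'"
      using sign_residue_eq_iff[OF t(3,4)] by (simp only: t(1,2) param_cong.simps prod.case simp_thms)
  qed (simp_all add: zeta_cube cnj_zeta hull_insert_1 zeta_not_mem_hull)
qed

lemma Gal_C3_times_S3:
  assumes "pure_cubic_real c"
  shows "Gal (gens_field zeta c) \<cong> integer_mod_group 3 \<times>\<times> sym_group 3"
proof -
  interpret pure_cubic_real c by fact
  let ?A = "{(e, j, k). e \<in> {1, - 1 :: int} \<and> (zeta = 1 \<longrightarrow> j = (0 :: int)) \<and> (c = 1 \<longrightarrow> k = (0 :: int))}"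
  let ?\<psi> = "\<lambda>(e, j :: int, k). (j mod 3, affine_perm e k)"
  show ?thesis
  proof (rule Gal_gens_field_iso[where \<psi> = ?\<psi>])
    \<comment> \<open>Moving \<open>j\<close> to the front turns the parameter set into a product on
      which \<psi> acts as a \<open>map_prod\<close>.\<close>
    have "?A = (\<lambda>(j, e, k). (e, j, k)) ` (UNIV \<times> {1, - 1} \<times> UNIV)"
      using c_neq zeta_neq_1 by (auto simp: image_iff)
    then have "?\<psi> ` ?A = ?\<psi> ` (\<lambda>(j, e, k). (e, j, k)) ` (UNIV \<times> {1, - 1} \<times> UNIV)"
      by (rule arg_cong)
    also have "\<dots> = map_prod (\<lambda>j. j mod 3) (\<lambda>(e, k). affine_perm e k) ` (UNIV \<times> {1, - 1} \<times> UNIV)"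
      by (simp only: image_image case_prod_unfold fst_conv snd_conv map_prod_def)
    also have "\<dots> = range (\<lambda>j :: int. j mod 3) \<times> (\<lambda>(e, k). affine_perm e k) ` ({1, - 1} \<times> UNIV)"
      by (rule map_prod_surj_on) simp_all
    also have "range (\<lambda>j :: int. j mod 3) = carrier (integer_mod_group 3)"
      by (auto simp: carrier_integer_mod_group image_iff intro!: mod_pos_pos_trivial[symmetric] exI)
    finally show "?\<psi> ` ?A = carrier (integer_mod_group 3 \<times>\<times> sym_group 3)"
      by (simp only: affine_perm_surj carrier_DirProd)
  next
    fix t t' assume "t \<in> ?A" "t' \<in> ?A"
    then obtain e j k e' j' k' where t: "t = (e, j, k)" "t' = (e', j', k')"
      and e: "e \<in> {1, - 1}" "e' \<in> {1, - 1}"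
      by blast
    show "?\<psi> (param_mult t t') = ?\<psi> t \<otimes>\<^bsub>integer_mod_group 3 \<times>\<times> sym_group 3\<^esub> ?\<psi> t'"
      by (simp add: t sym_group_mult affine_perm_comp mod_add_eq)
    show "?\<psi> t = ?\<psi> t' \<longleftrightarrow> param_cong t t'"
      by (auto simp: t affine_perm_eq_iff[OF e])
  qed (simp_all add: zeta_cube cnj_zeta cube_c cnj_c c_neq zeta_not_mem_hull_c c_not_mem_hull_zeta)
qed

section \<open>Splitting fields of the two polynomial shapes\<close>

lemma poly_of_rat_binomial:
  fixes z :: complex
  shows "poly (map_poly of_rat (Polynomial.monom 1 6 + [:b:])) z = z ^ 6 + of_rat b"
proof -
  have "map_poly of_rat (Polynomial.monom 1 6 + [:b:]) = (Polynomial.monom 1 6 + [:of_rat b:] :: complex poly)"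
    by (rule poly_eqI) (auto simp: coeff_map_poly of_rat_add coeff_pCons split: nat.splits)
  then show ?thesis by (simp add: poly_monom)
qed

lemma poly_of_rat_trinomial:
  fixes z :: complex
  shows "poly (map_poly of_rat (Polynomial.monom 1 6 + Polynomial.monom a 3 + [:b:])) z =
    z ^ 6 + of_rat a * z ^ 3 + of_rat b"
proof -
  have "map_poly of_rat (Polynomial.monom 1 6 + Polynomial.monom a 3 + [:b:]) =
      (Polynomial.monom 1 6 + Polynomial.monom (of_rat a) 3 + [:of_rat b:] :: complex poly)"
    by (rule poly_eqI) (auto simp: coeff_map_poly of_rat_add coeff_pCons split: nat.splits)
  then show ?thesis by (simp add: poly_monom)
qed

text \<open>Since \<open>(2 omega + 1)^2 = -3\<close>, a root \<open>z\<close> has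
  \<open>z^3\<close> equal to \<open>m (2 omega + 1)\<close> up to sign, while \<open>z^2\<close> is
  a cube root of \<open>- c^3\<close>. So \<open>z = z^3 / z^2\<close> lies in the field, and
  conversely \<open>z^2\<close> and \<open>z^3\<close> give back \<open>c\<close> and
  \<open>omega\<close>.\<close>

lemma splitting_field_binomial:
  fixes m :: rat and c :: complex
  assumes "m \<noteq> 0" and c: "c ^ 3 = 3 * of_rat m ^ 2"
  shows "splitting_field (Polynomial.monom 1 6 + [:3 * m\<^sup>2:]) = complex_ring (gens_field 1 c)"
proof (rule splitting_field_eq)
  let ?L = "gens_field 1 c" and ?m = "of_rat m :: complex"
  have roots: "poly (map_poly of_rat (Polynomial.monom 1 6 + [:3 * m\<^sup>2:])) z = 0 \<longleftrightarrow> z ^ 6 = - (c ^ 3)"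
    for z :: complex
    unfolding poly_of_rat_binomial c by (simp add: of_rat_mult of_rat_power eq_neg_iff_add_eq_0)
  have sqrt: "(?m * (2 * omega + 1))\<^sup>2 = - (c ^ 3)"
    unfolding c using omega_sum by Groebner_Basis.algebra
  have z3: "z ^ 3 = ?m * (2 * omega + 1) \<or> z ^ 3 = - (?m * (2 * omega + 1))" if "z ^ 6 = - (c ^ 3)" for z
  proof -
    have "(z ^ 3)\<^sup>2 = (?m * (2 * omega + 1))\<^sup>2"
      unfolding sqrt that[symmetric] by (simp flip: power_mult)
    then show ?thesis by (simp only: power2_eq_iff)
  qed
  show "complex_subfield ?L" by (rule subfield_gens_field)
  then interpret L: complex_subfield ?L .
  have m_mem: "?m \<in> ?L" using L.Rats_subset by auto
  show "{z. poly (map_poly of_rat (Polynomial.monom 1 6 + [:3 * m\<^sup>2:])) z = 0} \<subseteq> ?L"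
  proof (clarsimp simp only: roots mem_Collect_eq subset_iff)
    fix z :: complex assume z: "z ^ 6 = - (c ^ 3)"
    then have "(z\<^sup>2) ^ 3 = (- c) ^ 3" by (simp flip: power_mult)
    then obtain i where "z\<^sup>2 = omega ^ i * (- c)" by (rule cube_eq_cases)
    then have "z\<^sup>2 \<in> ?L" by (simp add: L.mem_intros gens_mem)
    moreover have "z ^ 3 \<in> ?L"
      using z3[OF z] by (elim disjE) (simp_all only: L.mem_intros gens_mem m_mem)
    ultimately have "z ^ 3 / z\<^sup>2 \<in> ?L" by (simp only: L.divide_mem)
    then show "z \<in> ?L" by (cases "z = 0") (simp_all add: L.zero_mem power3_eq_cube power2_eq_square)
  qed
  fix S assume "complex_subfield S"
    and S: "{z. poly (map_poly of_rat (Polynomial.monom 1 6 + [:3 * m\<^sup>2:])) z = 0} \<subseteq> S"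
  then interpret S: complex_subfield S by simp
  \<comment> \<open>A root with \<open>z^2\<close> equal to \<open>- c\<close> exactly, not just up
    to a cube root of unity, so \<open>c\<close> is recovered without \<open>omega\<close>.\<close>
  define z where "z = csqrt (- c)"
  have z2: "z\<^sup>2 = - c" by (simp add: z_def)
  then have z: "z ^ 6 = - (c ^ 3)" by Groebner_Basis.algebra
  then have zS: "z \<in> S" using S by (auto simp: roots)
  show "?L \<subseteq> S"
  proof (rule gens_field_minimal)
    have "c = - (z\<^sup>2)" by (simp add: z2)
    then show "c \<in> S" using zS by (simp add: S.mem_intros)
    have "z ^ 3 / ?m = 2 * omega + 1 \<or> - (z ^ 3) / ?m = 2 * omega + 1"
      using z3[OF z] assms(1) by auto
    then have "omega = (z ^ 3 / ?m - 1) / 2 \<or> omega = (- (z ^ 3) / ?m - 1) / 2"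
      by auto
    moreover have "?m \<in> S" using S.Rats_subset by auto
    then have "(z ^ 3 / ?m - 1) / 2 \<in> S" "(- (z ^ 3) / ?m - 1) / 2 \<in> S"
      using zS by (simp_all only: S.mem_intros)
    ultimately show "omega \<in> S" by metis
  qed (simp_all add: \<open>complex_subfield S\<close> S.one_mem)
qed

text \<open>The polynomial factors as \<open>(x^3 - q omega) (x^3 - q omega^2)\<close>, with roots
  \<open>c zeta\<close> and \<open>c zeta^2\<close> up to powers of \<open>omega\<close>; their
  quotient is \<open>zeta\<close>. A rational \<open>c\<close> is allowed, which serves the second
  family.\<close>

lemma splitting_field_trinomial:
  fixes q :: rat and c :: complex
  assumes "q \<noteq> 0" and c: "c ^ 3 = of_rat q"
  shows "splitting_field (Polynomial.monom 1 6 + Polynomial.monom q 3 + [:q\<^sup>2:]) =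
    complex_ring (gens_field zeta c)"
proof (rule splitting_field_eq)
  let ?L = "gens_field zeta c"
  have c0: "c \<noteq> 0" using c assms(1) by auto
  have roots: "poly (map_poly of_rat (Polynomial.monom 1 6 + Polynomial.monom q 3 + [:q\<^sup>2:])) z = 0 \<longleftrightarrow>
      z ^ 3 = (c * zeta) ^ 3 \<or> z ^ 3 = (c * zeta\<^sup>2) ^ 3" for z :: complex
  proof -
    have "(z ^ 3 - (c * zeta) ^ 3) * (z ^ 3 - (c * zeta\<^sup>2) ^ 3) = z ^ 6 + c ^ 3 * z ^ 3 + (c ^ 3)\<^sup>2"
      using omega_sum unfolding zeta_cube[symmetric] by Groebner_Basis.algebra
    then show ?thesis
      unfolding poly_of_rat_trinomial of_rat_power c[symmetric]
      by (metis mult_eq_0_iff right_minus_eq)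
  qed
  show "complex_subfield ?L" by (rule subfield_gens_field)
  then interpret L: complex_subfield ?L .
  show "{z. poly (map_poly of_rat (Polynomial.monom 1 6 + Polynomial.monom q 3 + [:q\<^sup>2:])) z = 0} \<subseteq> ?L"
  proof (clarsimp simp only: roots mem_Collect_eq subset_iff)
    fix z :: complex assume "z ^ 3 = (c * zeta) ^ 3 \<or> z ^ 3 = (c * zeta\<^sup>2) ^ 3"
    then obtain i where "z = omega ^ i * (c * zeta) \<or> z = omega ^ i * (c * zeta\<^sup>2)"
      by (metis cube_eq_cases)
    then show "z \<in> ?L" by (elim disjE) (simp_all add: L.mem_intros gens_mem)
  qed
  fix S assume "complex_subfield S"
    and S: "{z. poly (map_poly of_rat (Polynomial.monom 1 6 + Polynomial.monom q 3 + [:q\<^sup>2:])) z = 0} \<subseteq> S"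
  then interpret S: complex_subfield S by simp
  have S2: "c * zeta \<in> S" "c * zeta\<^sup>2 \<in> S" using S by (auto simp: roots)
  have "zeta \<noteq> 0" by (simp add: zeta_def)
  then have eq: "zeta = (c * zeta\<^sup>2) / (c * zeta)" "c = (c * zeta) / zeta"
    using c0 by (simp_all add: power2_eq_square)
  have zeta: "zeta \<in> S" using S2 by (subst eq(1)) (rule S.divide_mem)
  show "?L \<subseteq> S"
  proof (rule gens_field_minimal)
    show "omega \<in> S" unfolding zeta_cube[symmetric] using zeta by (rule S.power_mem)
    show "c \<in> S" using S2(1) zeta by (subst eq(2)) (rule S.divide_mem)
  qed (simp_all add: \<open>complex_subfield S\<close> zeta)
qed

lemma gens_field_rational:
  assumes "c \<in> \<rat>"
  shows "gens_field z c = gens_field z 1"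
proof
  have "c \<in> gens_field z d" "1 \<in> gens_field z d" for d
    using assms complex_subfield.Rats_subset[OF subfield_gens_field]
      complex_subfield.one_mem[OF subfield_gens_field] by auto
  then show "gens_field z c \<subseteq> gens_field z 1" "gens_field z 1 \<subseteq> gens_field z c"
    by (intro gens_field_minimal subfield_gens_field gens_mem; simp)+
qed

section \<open>Irrational cube roots of integers\<close>

lemma pure_cubic_realI:
  fixes q :: int and c :: complex
  assumes "c ^ 3 = of_int q" "cnj c = c" "\<And>n :: int. n ^ 3 \<noteq> q"
  shows "pure_cubic_real c"
proof
  show "c \<notin> \<rat>"
  proof
    assume c: "c \<in> \<rat>"
    have "c ^ 3 + of_int 0 * c + of_int (- q) = 0" using assms(1) by simp
    then show False using rational_root_cubic[OF c] assms(3) by (metis add.right_neutral add_eq_0_iff2 minus_minus mult_zero_left)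
  qed
qed (use assms in auto)

text \<open>Divisibility of \<open>n\<close> by 3 would give \<open>9 k^3 = (3 l + 1)^2\<close>,
  impossible modulo 3.\<close>

lemma three_times_square_not_cube:
  fixes l n :: int
  shows "n ^ 3 \<noteq> 3 * (3 * l + 1)\<^sup>2"
proof
  assume eq: "n ^ 3 = 3 * (3 * l + 1)\<^sup>2"
  then have "3 dvd n ^ 3" by simp
  then have "3 dvd n" using prime_dvd_power_int[of 3 n 3] by simp
  then obtain k where "n = 3 * k" ..
  with eq have "9 * k ^ 3 = 9 * l\<^sup>2 + 6 * l + 1" by (simp add: power2_eq_square power3_eq_cube algebra_simps)
  then show False by presburger
qed

lemma prime_not_cube:
  fixes p :: nat and n :: int
  assumes "Factorial_Ring.prime p"
  shows "n ^ 3 \<noteq> int p"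
proof
  assume eq: "n ^ 3 = int p"
  have p: "Factorial_Ring.prime (int p)" using assms by simp
  have "int p dvd n ^ 3" by (simp add: eq)
  then have "int p dvd n" using p prime_dvd_power by blast
  then obtain k where "n = int p * k" ..
  then have "int p * (int p * (int p * k ^ 3)) = int p * 1"
    using eq by (simp add: power3_eq_cube algebra_simps)
  then have "int p * (int p * k ^ 3) = 1" using p by (simp only: mult_cancel_left) auto
  then have "int p dvd 1" by (metis dvd_triv_left)
  then show False using p not_prime_unit by blast
qed

theorem corollary3p9:
  "(\<forall>n :: int.
      galois_group
        (splitting_field (Polynomial.monom 1 6 + [:3 * (3 * of_int n + 1) ^ 2:])) \<rat>
      \<cong> sym_group 3) \<and>
   (\<forall>n :: int.
      galois_group
        (splitting_field (Polynomial.monom 1 6 + Polynomial.monom ((5 * of_int n + 1) ^ 3) 3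
           + [:(5 * of_int n + 1) ^ 6:])) \<rat>
      \<cong> integer_mod_group 6) \<and>
   (\<forall>p :: nat. Factorial_Ring.prime p \<and> [p = 1] (mod 5) \<longrightarrow>
      galois_group
        (splitting_field (Polynomial.monom 1 6 + Polynomial.monom (of_nat p) 3
           + [:of_nat p ^ 2:])) \<rat>
      \<cong> integer_mod_group 3 \<times>\<times> sym_group 3)"
proof (intro conjI allI impI)
  fix n :: int
  let ?m = "3 * of_int n + 1 :: rat"
  have m: "?m = of_int (3 * n + 1)" by simp
  have "3 * n + 1 \<noteq> 0" by presburger
  then have m0: "?m \<noteq> 0" unfolding m of_int_eq_0_iff .
  obtain c :: complex where c: "c ^ 3 = of_int (3 * (3 * n + 1)\<^sup>2)" "cnj c = c"
    by (rule exists_real_cube_root)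
  have "c ^ 3 = 3 * of_rat ?m ^ 2" unfolding c m of_rat_of_int_eq by simp
  moreover have "pure_cubic_real c"
    using c three_times_square_not_cube by (rule pure_cubic_realI)
  ultimately show "galois_group (splitting_field (Polynomial.monom 1 6 + [:3 * ?m ^ 2:])) \<rat>
      \<cong> sym_group 3"
    using Gal_sym_group_3 splitting_field_binomial[OF m0] by simp
next
  fix n :: int
  let ?a = "5 * of_int n + 1 :: rat"
  have a: "?a = of_int (5 * n + 1)" by simp
  have "5 * n + 1 \<noteq> 0" by presburger
  then have "?a \<noteq> 0" unfolding a of_int_eq_0_iff .
  then have "?a ^ 3 \<noteq> 0" by simp
  \<comment> \<open>The second family is the trinomial with \<open>q = ?a ^ 3\<close>, whose cube
    root \<open>?a\<close> is rational and contributes no generator.\<close>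
  then have "splitting_field (Polynomial.monom 1 6 + Polynomial.monom (?a ^ 3) 3 + [:(?a ^ 3)\<^sup>2:]) =
      complex_ring (gens_field zeta (of_rat ?a))"
    by (rule splitting_field_trinomial) (simp only: of_rat_power)
  also have "(?a ^ 3)\<^sup>2 = ?a ^ 6" by (simp flip: power_mult)
  also have "gens_field zeta (of_rat ?a) = gens_field zeta 1"
    by (rule gens_field_rational) (rule Rats_of_rat)
  finally show "galois_group (splitting_field (Polynomial.monom 1 6 + Polynomial.monom (?a ^ 3) 3
      + [:?a ^ 6:])) \<rat> \<cong> integer_mod_group 6"
    using Gal_cyclic_6 by simp
next
  fix p :: nat
  assume p: "Factorial_Ring.prime p \<and> [p = 1] (mod 5)"
  obtain c :: complex where c: "c ^ 3 = of_int (int p)" "cnj c = c"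
    by (rule exists_real_cube_root)
  have "pure_cubic_real c"
    using c prime_not_cube[OF conjunct1[OF p]] by (rule pure_cubic_realI)
  moreover have "c ^ 3 = of_rat (of_nat p)" using c by simp
  moreover have "of_nat p \<noteq> (0 :: rat)" using p prime_gt_0_nat[of p] by simp
  ultimately show "galois_group (splitting_field (Polynomial.monom 1 6 + Polynomial.monom (of_nat p) 3
      + [:of_nat p ^ 2:])) \<rat> \<cong> integer_mod_group 3 \<times>\<times> sym_group 3"
    using Gal_C3_times_S3 splitting_field_trinomial by metis
qed

end
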